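(* Let $k \geq 3$ be an integer. Then for all sufficiently large $t$, \[ R(t,\mathcal{B}_{2k}) \leq t^{\frac{2k}{2k-1} + \frac{4}{\sqrt{\log t}}}. \]
   Context: A $3$-graph is a hypergraph all of whose edges have size $3$. An independent set in a hypergraph is a set of vertices containing no edge. For $k\ge 2$, a Berge $k$-cycle is a family of sets $e_1,\dots,e_k$ such that the sets $e_1\cap e_2, e_2\cap e_3,\dots,e_{k-1}\cap e_k, e_k\cap e_1$ have a system of distinct representatives; it is non-trivial if $e_1\cap e_2\cap\dots\cap e_k=\emptyset$. $\mathcal{B}_k$ denotes the family of all non-trivial Berge $k$-cycles all of whose sets have size $3$. For a family $\mathcal{F}$ of $3$-graphs, $R(t,\mathcal{F})$ is the minimum $n$ such that every $n$-vertex $3$-graph contains either a member of $\mathcal{F}$ (as a subhypergraph, i.e. edges of the hypergraph forming such a family) or an independent set of size $t$. Here $\log$ denotes the natural logarithm. *)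

theory Defs
  imports Complex_Main "HOL-Library.Ramsey"
begin

definition three_graph :: "'a set \<Rightarrow> 'a set set \<Rightarrow> bool" where
  "three_graph V E \<longleftrightarrow> finite V \<and> E \<subseteq> [V]\<^bsup>3\<^esup>"

definition independent_in :: "'a set set \<Rightarrow> 'a set \<Rightarrow> bool" where
  "independent_in E I \<longleftrightarrow> (\<forall>e\<in>E. \<not> e \<subseteq> I)"

text \<open>The sets of a Berge cycle are pairwise distinct; they are listed in cyclic order as
  \<open>e 0, \<dots>, e (k - 1)\<close>, and \<open>r\<close> is the system of distinct representatives.\<close>

definition berge_cycle :: "nat \<Rightarrow> (nat \<Rightarrow> 'a set) \<Rightarrow> bool" where
  "berge_cycle k e \<longleftrightarrow> inj_on e {..<k} \<and>
     (\<exists>r. inj_on r {..<k} \<and> (\<forall>i<k. r i \<in> e i \<inter> e (Suc i mod k)))"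

definition nontrivial_berge_cycles :: "nat \<Rightarrow> 'a set set set" where
  "nontrivial_berge_cycles k =
     {e ` {..<k} |e. berge_cycle k e \<and> (\<Inter>i<k. e i) = {} \<and> (\<forall>i<k. card (e i) = 3)}"

text \<open>A family of 3-graphs is given by the edge sets of its members and is meant to be closed under
  renaming of vertices, so that containing a copy of a member is inclusion of edge sets.
  Up to isomorphism, every finite 3-graph has its vertices in \<open>nat\<close>.\<close>

definition ramsey_prop :: "nat \<Rightarrow> nat set set set \<Rightarrow> nat \<Rightarrow> bool" where
  "ramsey_prop t F n \<longleftrightarrow>
     (\<forall>V E. three_graph V E \<and> card V = n \<longrightarrow>
        (\<exists>H\<in>F. H \<subseteq> E) \<or> (\<exists>I\<subseteq>V. card I = t \<and> independent_in E I))"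

definition ramsey_number :: "nat \<Rightarrow> nat set set set \<Rightarrow> nat" where
  "ramsey_number t F = (LEAST n. ramsey_prop t F n)"

text \<open>The minimum exists, because a complete 3-graph on \<open>2 k\<close> vertices contains a loose \<open>k\<close>-cycle.\<close>

lemma complete_contains_nontrivial_berge_cycle:
  fixes U :: "'a set"
  assumes k: "k \<ge> 3" and U: "finite U" "card U = 2 * k" and E: "[U]\<^bsup>3\<^esup> \<subseteq> E"
  shows "\<exists>H\<in>nontrivial_berge_cycles k. H \<subseteq> E"
proof -
  obtain h where h: "bij_betw h {..<2 * k} U"
    using U ex_bij_betw_nat_finite[of U] by (auto simp: atLeast0LessThan)
  have inj: "inj_on h {..<2 * k}" and im: "h ` {..<2 * k} = U"
    using h by (auto simp: bij_betw_def)
  define s where "s i = Suc i mod k" for i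
  have s_lt: "s i < k" for i using k by (simp add: s_def)
  have s_alt: "s i = (if Suc i = k then 0 else Suc i)" if "i < k" for i
    using that k by (auto simp: s_def)
  have s_ne: "s i \<noteq> i" if "i < k" for i using that k by (auto simp: s_alt split: if_splits)
  have s_inj: "inj_on s {..<k}" by (rule inj_onI) (auto simp: s_alt split: if_splits)
  define c where "c i = {i, s i, k + i}" for i
  define e where "e i = h ` c i" for i
  have c_sub: "c i \<subseteq> {..<2 * k}" if "i < k" for i
    using that s_lt[of i] by (auto simp: c_def)
  have c_card: "card (c i) = 3" if "i < k" for i
    using that s_lt[of i] s_ne[of i] by (auto simp: c_def)
  have e_card: "card (e i) = 3" if "i < k" for i
    unfolding e_def using card_image[OF inj_on_subset[OF inj c_sub[OF that]]] c_card[OF that] by simp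
  have e_sub: "e i \<subseteq> U" if "i < k" for i
    unfolding e_def using c_sub[OF that] im by blast
  have mem: "h j \<in> e i \<longleftrightarrow> j \<in> c i" if "i < k" "j < 2 * k" for i j
    unfolding e_def using inj_on_image_mem_iff[OF inj, of j "c i"] c_sub[OF that(1)] that by auto
  have e_inj: "inj_on e {..<k}"
  proof (rule inj_onI)
    fix i j assume ij: "i \<in> {..<k}" "j \<in> {..<k}" and eq: "e i = e j"
    have "h (k + i) \<in> e i" using ij by (subst mem) (auto simp: c_def)
    then have "k + i \<in> c j" using eq ij by (subst (asm) eq, subst (asm) mem) auto
    then show "i = j" using ij s_lt[of j] by (auto simp: c_def)
  qed
  have r: "inj_on (\<lambda>i. h (s i)) {..<k}"
  proof (rule inj_onI)
    fix i j assume ij: "i \<in> {..<k}" "j \<in> {..<k}" and eq: "h (s i) = h (s j)"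
    have "s i < 2 * k" "s j < 2 * k" using s_lt[of i] s_lt[of j] by linarith+
    with eq have "s i = s j" using inj by (auto dest: inj_onD)
    then show "i = j" using s_inj ij by (auto dest: inj_onD)
  qed
  have "berge_cycle k e"
    unfolding berge_cycle_def
  proof (intro conjI e_inj exI[of _ "\<lambda>i. h (s i)"] r allI impI)
    fix i assume "i < k"
    show "h (s i) \<in> e i \<inter> e (Suc i mod k)"
      unfolding s_def[symmetric] by (auto simp: e_def c_def)
  qed
  moreover have "(\<Inter>i<k. e i) = {}"
  proof (rule ccontr)
    assume "\<not> ?thesis"
    then obtain x where x: "\<forall>i<k. x \<in> e i" by auto
    then have "x \<in> e 0" using k by auto
    then obtain j where j: "j \<in> c 0" "x = h j" by (auto simp: e_def)
    have "j < 2 * k" using j c_sub[of 0] k by auto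
    then have "j \<in> c i" if "i < k" for i using x j mem[OF that] that by auto
    then have "j \<in> c 0" "j \<in> c 1" "j \<in> c 2" using k by auto
    then show False using k s_alt[of 0] s_alt[of 1] s_alt[of 2] by (auto simp: c_def split: if_splits)
  qed
  ultimately have "e ` {..<k} \<in> nontrivial_berge_cycles k"
    using e_card unfolding nontrivial_berge_cycles_def by blast
  moreover have "e ` {..<k} \<subseteq> E"
  proof -
    have "e i \<in> [U]\<^bsup>3\<^esup>" if "i < k" for i
      using e_sub[OF that] e_card[OF that] finite_subset[OF _ U(1)] by (auto simp: nsets_def)
    then show ?thesis using E by auto
  qed
  ultimately show ?thesis by blast
qed

lemma ramsey_prop_nontrivial_berge_cycles:
  assumes k: "k \<ge> 3"
  shows "\<exists>n. ramsey_prop t (nontrivial_berge_cycles k) n"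
proof -
  obtain n :: nat where n: "partn_lst {..<n} [t, 2 * k] 3" using ramsey_full by blast
  have "(\<exists>H\<in>nontrivial_berge_cycles k. H \<subseteq> E) \<or> (\<exists>I\<subseteq>V. card I = t \<and> independent_in E I)"
    if VE: "three_graph V E" and card: "card V = n" for V :: "nat set" and E
  proof -
    have V: "finite V" and sub: "E \<subseteq> [V]\<^bsup>3\<^esup>" using VE by (auto simp: three_graph_def)
    obtain h where h: "bij_betw h {..<n} V"
      using V card ex_bij_betw_nat_finite[of V] by (auto simp: atLeast0LessThan)
    define f where "f X = (if h ` X \<in> E then 1 else 0::nat)" for X
    have "f \<in> [{..<n}]\<^bsup>3\<^esup> \<rightarrow> {..<2}" by (auto simp: f_def)
    then obtain i H where i: "i < 2" and H: "H \<in> [{..<n}]\<^bsup>([t, 2 * k] ! i)\<^esup>"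
      and mono: "f ` [H]\<^bsup>3\<^esup> \<subseteq> {i}"
      by (rule partn_lstE[OF n, of f 2]) (simp_all add: numeral_2_eq_2)
    have Hn: "H \<subseteq> {..<n}" "card H = [t, 2 * k] ! i" "finite H" using H by (auto simp: nsets_def)
    have injH: "inj_on h H" using h Hn(1) by (auto simp: bij_betw_def intro: inj_on_subset)
    have hH: "h ` H \<subseteq> V" "card (h ` H) = [t, 2 * k] ! i"
      using h Hn card_image[OF injH] by (auto simp: bij_betw_def)
    have nsets_im: "(\<lambda>X. h ` X) ` [H]\<^bsup>3\<^esup> = [h ` H]\<^bsup>3\<^esup>"
      using bij_betw_nsets[of h H "h ` H" 3] injH by (auto simp: bij_betw_def)
    consider "i = 0" | "i = 1" using i by linarith
    then show ?thesis
    proof cases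
      case 1
      have "independent_in E (h ` H)"
        unfolding independent_in_def
      proof (intro ballI notI)
        fix e assume e: "e \<in> E" "e \<subseteq> h ` H"
        then have "e \<in> [h ` H]\<^bsup>3\<^esup>" using sub by (auto simp: nsets_def)
        then obtain X where "X \<in> [H]\<^bsup>3\<^esup>" "e = h ` X" using nsets_im by blast
        then show False using mono e 1 by (auto simp: f_def split: if_splits)
      qed
      then show ?thesis using hH 1 by auto
    next
      case 2
      have "[h ` H]\<^bsup>3\<^esup> \<subseteq> E"
        unfolding nsets_im[symmetric] using mono 2 by (auto simp: f_def split: if_splits)
      then show ?thesis
        using complete_contains_nontrivial_berge_cycle[OF k, of "h ` H" E] hH Hn(3) 2 by auto
    qed
  qed
  then show ?thesis unfolding ramsey_prop_def by blast
qed

end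

theory Submission
  imports Defs "HOL-Analysis.Convex" "HOL-Real_Asymp.Real_Asymp"
begin

text \<open>Let \<open>H\<close> be a 3-graph on \<open>n\<close> vertices without non-trivial Berge \<open>2 k\<close>-cycle. Deleting vertices of
  large degree one by one, at most half of the vertices are lost before every degree is at most
  \<open>8 ln n\<close> times \<open>x = |E| / n\<close>. If every pair covered by a subgraph had codegree at least \<open>4 k\<close> in it,
  a path in the link of a vertex would give a \<open>2 k\<close>-cycle of covered pairs, which expands greedily;
  so peeling off pairs of small codegree assigns to every edge one of its pairs, at most \<open>4 k\<close>
  edges to each pair. The assigned pairs form a graph \<open>G\<close> of average degree of order \<open>x\<close>, and a
  \<open>2 k\<close>-cycle of \<open>G\<close> yields a Berge cycle, non-trivial unless one vertex lies in all its edges.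
  If \<open>x ^ k\<close> exceeds \<open>n\<close> by a power of \<open>ln n\<close>, then the closed \<open>2 k\<close>-walks of \<open>G\<close>, at least \<open>d ^ (2 k)\<close>
  in number for minimum degree \<open>d\<close> and maximum degree \<open>\<Delta>\<close>, outnumber both those with a repeated vertex and the at most
  \<open>n (2 \<Delta>) ^ k\<close> trivial ones. Hence \<open>x\<close> is at most \<open>n powr (1 / k)\<close> times a logarithmic factor, and a
  random colouring with about \<open>sqrt x\<close> colours has a class containing a large independent set.\<close>

section \<open>Closed walks in a graph\<close>

lemma card_UN_le_sum:
  assumes "finite I" "\<And>i. i \<in> I \<Longrightarrow> real (card (F i)) \<le> g i"
  shows "real (card (\<Union>i\<in>I. F i)) \<le> (\<Sum>i\<in>I. g i)"
proof -
  have "real (card (\<Union>i\<in>I. F i)) \<le> real (\<Sum>i\<in>I. card (F i))"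
    using card_UN_le[OF assms(1), of F] by linarith
  also have "\<dots> \<le> (\<Sum>i\<in>I. g i)"
    using assms(2) by (auto intro!: sum_mono)
  finally show ?thesis .
qed

text \<open>Cut into \<open>k\<close> disjoint consecutive pairs, the list is determined by
  \<open>k\<close> elements of \<open>L\<close>. The exponent \<open>k\<close>, about half the
  number of steps, is what makes trivial walks rare.\<close>

lemma card_lists_pairs_le:
  assumes "finite L"
  shows "finite {xs. length xs = 2 * k \<and> (\<forall>i<2 * k - 1. (xs ! i, xs ! Suc i) \<in> L)}"
    (is "finite (?S k)")
    and "card {xs. length xs = 2 * k \<and> (\<forall>i<2 * k - 1. (xs ! i, xs ! Suc i) \<in> L)} \<le> card L ^ k"
proof -
  let ?T = "{ps. set ps \<subseteq> L \<and> length ps = k}"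
  let ?f = "\<lambda>ps. concat (map (\<lambda>(a, b). [a, b]) ps)"
  have sub: "?S k \<subseteq> ?f ` {ps. set ps \<subseteq> L \<and> length ps = k}" for k
  proof (induction k)
    case (Suc k)
    show ?case
    proof
      fix xs assume xs: "xs \<in> ?S (Suc k)"
      then obtain a b ys where eq: "xs = a # b # ys" "length ys = 2 * k"
        by (auto simp: length_Suc_conv)
      have "(ys ! i, ys ! Suc i) \<in> L" if "i < 2 * k - 1" for i
      proof -
        have "\<forall>j<2 * k + 1. (xs ! j, xs ! Suc j) \<in> L" using xs by simp
        then have "(xs ! Suc (Suc i), xs ! Suc (Suc (Suc i))) \<in> L" using that by auto
        then show ?thesis by (simp add: eq)
      qed
      then have "ys \<in> ?S k" using eq by simp
      then obtain ps where "ys = ?f ps" "set ps \<subseteq> L" "length ps = k" using Suc by blast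
      moreover have "(a, b) \<in> L" using xs eq by auto
      ultimately show "xs \<in> ?f ` {ps. set ps \<subseteq> L \<and> length ps = Suc k}"
        by (intro image_eqI[of _ _ "(a, b) # ps"]) (auto simp: eq)
    qed
  qed auto
  have fT: "finite ?T" by (rule finite_lists_length_eq[OF assms])
  then show "finite (?S k)" using sub finite_subset by blast
  have "card (?S k) \<le> card (?f ` ?T)" using fT sub by (intro card_mono) auto
  also have "\<dots> \<le> card ?T" by (rule card_image_le[OF fT])
  finally show "card (?S k) \<le> card L ^ k" by (simp add: card_lists_length_eq[OF assms])
qed

locale finite_sym_rel =
  fixes V :: "'a set" and A :: "('a \<times> 'a) set"
  assumes finV: "finite V" and AV: "A \<subseteq> V \<times> V" and symA: "sym A"
begin

abbreviation walk :: "'a list \<Rightarrow> bool" where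
  "walk \<equiv> successively (\<lambda>x y. (x, y) \<in> A)"

definition walks :: "nat \<Rightarrow> 'a \<Rightarrow> 'a \<Rightarrow> 'a list set" where
  "walks l u v = {xs. length xs = Suc l \<and> hd xs = u \<and> last xs = v \<and> walk xs}"

definition nwalks :: "nat \<Rightarrow> 'a \<Rightarrow> 'a \<Rightarrow> real" where
  "nwalks l u v = real (card (walks l u v))"

text \<open>The initial vertex is not repeated at the end, so that \<open>distinct\<close> can
  express that the walk is a cycle.\<close>

definition closed_walks :: "nat \<Rightarrow> 'a list set" where
  "closed_walks l = {xs. length xs = l \<and> walk xs \<and> (last xs, hd xs) \<in> A}"

text \<open>This is the trace of the adjacency matrix to the power \<open>2 * l\<close>, so it
  counts closed walks of \<open>2 * l\<close> steps; the form as a sum of squares suits the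
  Cauchy-Schwarz inequality.\<close>

definition hom_count :: "nat \<Rightarrow> real" where
  "hom_count l = (\<Sum>u\<in>V. \<Sum>v\<in>V. (nwalks l u v)\<^sup>2)"

lemma A_sym: "(x, y) \<in> A \<longleftrightarrow> (y, x) \<in> A"
  using symA by (auto dest: symD)

lemma A_in: "(x, y) \<in> A \<Longrightarrow> x \<in> V \<and> y \<in> V"
  using AV by auto

lemma finA: "finite A"
  using finV AV by (meson finite_SigmaI finite_subset)

lemma fin_nbs: "finite (A `` {u})"
  using finA by auto

lemma walk_in_V: "walk xs \<Longrightarrow> hd xs \<in> V \<Longrightarrow> set xs \<subseteq> V"
proof (induction xs)
  case (Cons x xs)
  then show ?case by (cases xs) (auto dest: A_in)
qed auto

lemma walks_0: "walks 0 u v = (if u = v then {[u]} else {})"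
  by (auto simp: walks_def length_Suc_conv)

lemma walks_Suc: "walks (Suc l) u v = (\<Union>w\<in>A `` {u}. (#) u ` walks l w v)"
proof (intro equalityI subsetI)
  fix xs assume "xs \<in> walks (Suc l) u v"
  then have xs: "length xs = Suc (Suc l)" "hd xs = u" "last xs = v" "walk xs"
    by (auto simp: walks_def)
  then obtain ys where ys: "xs = u # ys" "length ys = Suc l" by (auto simp: length_Suc_conv)
  then have "ys \<noteq> []" by auto
  then have "ys \<in> walks l (hd ys) v" "(u, hd ys) \<in> A"
    using xs ys by (auto simp: walks_def successively_Cons)
  then show "xs \<in> (\<Union>w\<in>A `` {u}. (#) u ` walks l w v)" using ys by blast
next
  fix xs assume "xs \<in> (\<Union>w\<in>A `` {u}. (#) u ` walks l w v)"
  then show "xs \<in> walks (Suc l) u v"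
    by (auto simp: walks_def successively_Cons)
qed

lemma finite_walks: "finite (walks l u v)"
  by (induction l arbitrary: u) (auto simp: walks_0 walks_Suc fin_nbs)

lemma nwalks_0: "nwalks 0 u v = (if u = v then 1 else 0)"
  by (simp add: nwalks_def walks_0)

lemma nwalks_Suc: "nwalks (Suc l) u v = (\<Sum>w\<in>A `` {u}. nwalks l w v)"
proof -
  have "card (walks (Suc l) u v) = (\<Sum>w\<in>A `` {u}. card ((#) u ` walks l w v))"
    unfolding walks_Suc
    by (rule card_UN_disjoint) (auto simp: fin_nbs finite_walks, auto simp: walks_def)
  also have "\<dots> = (\<Sum>w\<in>A `` {u}. card (walks l w v))"
    by (simp add: card_image)
  finally show ?thesis by (simp add: nwalks_def)
qed

lemma nwalks_nonneg: "nwalks l u v \<ge> 0"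
  by (simp add: nwalks_def)

lemma nwalks_sym: "nwalks l u v = nwalks l v u"
proof -
  have "rev ` walks l u v \<subseteq> walks l v u" for u v
    by (auto simp: walks_def hd_rev last_rev A_sym)
  then have "card (walks l u v) \<le> card (walks l v u)" for u v
    by (intro card_inj_on_le[of rev]) (auto simp: finite_walks)
  then show ?thesis by (simp add: nwalks_def order_antisym)
qed

lemma nwalks_add:
  assumes "u \<in> V"
  shows "nwalks (a + b) u v = (\<Sum>w\<in>V. nwalks a u w * nwalks b w v)"
  using assms
proof (induction a arbitrary: u)
  case 0
  have "(\<Sum>w\<in>V. nwalks 0 u w * nwalks b w v) = (\<Sum>w\<in>V. if u = w then nwalks b w v else 0)"
    by (rule sum.cong) (auto simp: nwalks_0)
  then show ?case using 0 finV by simp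
next
  case (Suc a)
  have "nwalks (Suc a + b) u v = (\<Sum>x\<in>A `` {u}. nwalks (a + b) x v)"
    by (simp add: nwalks_Suc)
  also have "\<dots> = (\<Sum>x\<in>A `` {u}. \<Sum>w\<in>V. nwalks a x w * nwalks b w v)"
    using Suc.IH A_in by (intro sum.cong) auto
  also have "\<dots> = (\<Sum>w\<in>V. \<Sum>x\<in>A `` {u}. nwalks a x w * nwalks b w v)"
    by (rule sum.swap)
  also have "\<dots> = (\<Sum>w\<in>V. nwalks (Suc a) u w * nwalks b w v)"
    by (simp add: nwalks_Suc sum_distrib_right)
  finally show ?case .
qed

text \<open>Reversing one of the two walks from \<open>u\<close> to \<open>v\<close> and joining it
  to the other gives a closed walk at \<open>u\<close>. The same total length can thus be split in
  different ways.\<close>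

lemma sum_nwalks_mult:
  "(\<Sum>u\<in>V. \<Sum>v\<in>V. nwalks a u v * nwalks b u v) = (\<Sum>u\<in>V. nwalks (a + b) u u)"
  by (intro sum.cong refl) (simp add: nwalks_add nwalks_sym[of b])

lemma hom_count_eq: "hom_count l = (\<Sum>u\<in>V. nwalks (2 * l) u u)"
  using sum_nwalks_mult[of l l] by (simp add: hom_count_def power2_eq_square mult_2)

lemma card_closed_walks: 
  assumes "l \<ge> 1"
  shows "finite (closed_walks l)" "real (card (closed_walks l)) = (\<Sum>u\<in>V. nwalks l u u)"
proof -
  obtain m where m: "l = Suc m" using assms by (cases l) auto
  have eq: "closed_walks l = (\<Union>u\<in>V. \<Union>v\<in>A `` {u}. walks m u v)"
    unfolding closed_walks_def walks_def m using A_sym A_in by blast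
  show "finite (closed_walks l)"
    unfolding eq using finV by (auto simp: fin_nbs finite_walks)
  have "card (closed_walks l) = (\<Sum>u\<in>V. card (\<Union>v\<in>A `` {u}. walks m u v))"
    unfolding eq by (rule card_UN_disjoint) (auto simp: finV fin_nbs finite_walks, auto simp: walks_def)
  also have "\<dots> = (\<Sum>u\<in>V. \<Sum>v\<in>A `` {u}. card (walks m u v))"
    by (intro sum.cong refl card_UN_disjoint)
      (auto simp: finV fin_nbs finite_walks, auto simp: walks_def)
  finally show "real (card (closed_walks l)) = (\<Sum>u\<in>V. nwalks l u u)"
    unfolding m nwalks_Suc by (simp add: nwalks_sym[of m _ "_::'a"] nwalks_def[symmetric])
qed

section \<open>Growth of the closed walk counts\<close>

lemma hom_count_nonneg: "hom_count l \<ge> 0"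
  by (auto simp: hom_count_def intro!: sum_nonneg)

text \<open>A closed walk of \<open>2 * l + 2\<close> steps can be cut into pieces of
  \<open>l\<close> and \<open>l + 2\<close> steps instead of two equal halves; Cauchy-Schwarz then
  separates the two lengths.\<close>

lemma hom_count_log_convex:
  "(hom_count (Suc l))\<^sup>2 \<le> hom_count l * hom_count (Suc (Suc l))"
proof -
  have eq: "hom_count (Suc l) = (\<Sum>(u, v)\<in>V \<times> V. nwalks l u v * nwalks (Suc (Suc l)) u v)"
    using sum_nwalks_mult[of l "Suc (Suc l)"]
    by (simp add: hom_count_eq sum.cartesian_product mult_2)
  have sq: "hom_count j = (\<Sum>p\<in>V \<times> V. (nwalks j (fst p) (snd p))\<^sup>2)" for j
    by (simp add: hom_count_def sum.cartesian_product case_prod_unfold)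
  show ?thesis
    unfolding eq sq[of l] sq[of "Suc (Suc l)"] case_prod_unfold
    by (rule Cauchy_Schwarz_ineq_sum)
qed

text \<open>By log-convexity the ratios of successive counts increase, so a bound on the last ratio
  bounds all earlier ones, and their product telescopes.\<close>

lemma hom_count_ratio:
  assumes "B \<ge> 0" "hom_count (Suc l) > 0" "hom_count (Suc l) \<le> B * hom_count l"
  shows "hom_count (Suc l) \<le> B ^ Suc l * hom_count 0"
  using assms(2,3)
proof (induction l)
  case (Suc l)
  have pos: "hom_count (Suc l) > 0"
    using Suc.prems hom_count_nonneg[of "Suc l"] by (cases "hom_count (Suc l) = 0") auto
  have "(hom_count (Suc l))\<^sup>2 \<le> hom_count l * (B * hom_count (Suc l))"
    using hom_count_log_convex[of l] Suc.prems(2) hom_count_nonneg[of l]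
    by (meson mult_left_mono order_trans)
  then have "hom_count (Suc l) \<le> B * hom_count l"
    using pos by (simp add: power2_eq_square mult.commute mult.left_commute)
  from Suc.IH[OF pos this] have "B * hom_count (Suc l) \<le> B * (B ^ Suc l * hom_count 0)"
    using assms(1) by (rule mult_left_mono)
  then show ?case using Suc.prems(2) by (simp add: mult.assoc)
qed simp

lemma hom_count_0: "hom_count 0 = real (card V)"
proof -
  have "hom_count 0 = (\<Sum>u\<in>V. \<Sum>v\<in>V. if u = v then 1 else 0)"
    unfolding hom_count_def by (intro sum.cong) (auto simp: nwalks_0)
  then show ?thesis using finV by simp
qed

lemma sum_nwalks_ge:
  assumes "d \<ge> 0" "\<And>v. v \<in> V \<Longrightarrow> d \<le> real (card (A `` {v}))" "u \<in> V"
  shows "d ^ l \<le> (\<Sum>v\<in>V. nwalks l u v)"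
  using assms(3)
proof (induction l arbitrary: u)
  case 0
  have "(\<Sum>v\<in>V. nwalks 0 u v) = (\<Sum>v\<in>V. if u = v then 1 else 0)"
    by (intro sum.cong) (auto simp: nwalks_0)
  then show ?case using 0 finV by simp
next
  case (Suc l)
  have "d ^ Suc l \<le> real (card (A `` {u})) * d ^ l"
    using assms Suc.prems by (simp add: mult_right_mono)
  also have "\<dots> = (\<Sum>w\<in>A `` {u}. d ^ l)" by simp
  also have "\<dots> \<le> (\<Sum>w\<in>A `` {u}. \<Sum>v\<in>V. nwalks l w v)"
    using Suc.IH A_in by (intro sum_mono) auto
  also have "\<dots> = (\<Sum>v\<in>V. nwalks (Suc l) u v)"
    unfolding nwalks_Suc by (rule sum.swap)
  finally show ?case .
qed

text \<open>There are at least \<open>card V * d ^ l\<close> walks of \<open>l\<close> steps.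
  Cauchy-Schwarz over the \<open>(card V)\<^sup>2\<close> pairs of endpoints loses exactly what
  squaring \<open>card V\<close> gains.\<close>

lemma hom_count_ge:
  assumes "d \<ge> 0" "\<And>v. v \<in> V \<Longrightarrow> d \<le> real (card (A `` {v}))" "V \<noteq> {}"
  shows "d ^ (2 * l) \<le> hom_count l"
proof -
  have N: "real (card V) > 0" using assms(3) finV by (simp add: card_gt_0_iff)
  have "real (card V) * d ^ l \<le> (\<Sum>u\<in>V. \<Sum>v\<in>V. nwalks l u v)"
    using sum_mono[of V "\<lambda>_. d ^ l" "\<lambda>u. \<Sum>v\<in>V. nwalks l u v"] sum_nwalks_ge[OF assms(1,2)]
    by simp
  then have "(real (card V) * d ^ l)\<^sup>2 \<le> (\<Sum>u\<in>V. \<Sum>v\<in>V. nwalks l u v)\<^sup>2"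
    using assms(1) by (intro power_mono) auto
  also have "\<dots> = (\<Sum>p\<in>V \<times> V. 1 * nwalks l (fst p) (snd p))\<^sup>2"
    by (simp add: sum.cartesian_product case_prod_unfold)
  also have "\<dots> \<le> (\<Sum>p\<in>V \<times> V. 1\<^sup>2) * (\<Sum>p\<in>V \<times> V. (nwalks l (fst p) (snd p))\<^sup>2)"
    by (rule Cauchy_Schwarz_ineq_sum)
  also have "\<dots> = (real (card V))\<^sup>2 * hom_count l"
    by (simp add: hom_count_def sum.cartesian_product case_prod_unfold power2_eq_square
        card_cartesian_product)
  finally show ?thesis
    using N by (simp add: power_mult_distrib power_mult[symmetric] mult.commute)
qed

section \<open>Closed walks with a repeated vertex\<close>

definition bad_walks :: "nat \<Rightarrow> 'a list set" where
  "bad_walks k = {xs \<in> closed_walks (2 * k). hd xs \<in> set (take k (tl xs))}"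

text \<open>The rest of the walk after \<open>ys\<close> is recorded as a \<open>k\<close>-step walk
  \<open>t\<close> from \<open>last ys\<close> back to \<open>x\<close>, so that
  \<open>nwalks\<close> counts it; \<open>butlast (tl t)\<close> strips the two endpoints already
  listed.\<close>

lemma closed_walk_split:
  assumes "xs \<in> closed_walks (2 * k)" "k \<ge> 1"
  obtains x ys t where "xs = x # ys @ butlast (tl t)" "x \<in> V"
    "ys \<in> walks (k - 1) (hd ys) (last ys)" "t \<in> walks k (last ys) x" "(x, hd ys) \<in> A"
    "hd ys \<in> V" "last ys \<in> V" "ys = take k (tl xs)"
proof -
  have xs: "length xs = 2 * k" "walk xs" "(last xs, hd xs) \<in> A"
    using assms(1) by (auto simp: closed_walks_def)
  define x where "x = hd xs"
  define ys where "ys = take k (tl xs)"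
  define zs where "zs = drop k (tl xs)"
  have "xs \<noteq> []" using xs(1) assms(2) by auto
  then have eq: "xs = x # ys @ zs" by (simp add: x_def ys_def zs_def)
  have len: "length ys = k" using xs(1) assms(2) by (simp add: ys_def)
  then have ne: "ys \<noteq> []" using assms(2) by auto
  have w: "walk ys" "(x, hd ys) \<in> A"
    and w2: "walk zs" "zs = [] \<or> (last ys, hd zs) \<in> A"
    using xs(2) ne unfolding eq by (auto simp: successively_Cons successively_append_iff)
  have x: "x \<in> V" using xs(3) A_in x_def by blast
  have sub: "set xs \<subseteq> V" using walk_in_V[OF xs(2)] x x_def by simp
  have "walk (last ys # zs)" using w2 by (auto simp: successively_Cons)
  moreover have "(last (last ys # zs), x) \<in> A"
    using xs(3) ne unfolding eq by (auto split: if_splits)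
  ultimately have "walk ((last ys # zs) @ [x])"
    by (subst successively_append_iff) auto
  moreover have "length zs = k - 1" using xs(1) by (simp add: zs_def)
  ultimately have "last ys # zs @ [x] \<in> walks k (last ys) x"
    using assms(2) by (auto simp: walks_def)
  moreover have "ys \<in> walks (k - 1) (hd ys) (last ys)"
    using w len assms(2) by (auto simp: walks_def)
  moreover have "hd ys \<in> V" "last ys \<in> V" using sub ne unfolding eq by auto
  moreover have "xs = x # ys @ butlast (tl (last ys # zs @ [x]))" using eq by simp
  ultimately show ?thesis
    using x w(2) by (intro that[OF _ _ _ _ _ _ _ ys_def])
qed

text \<open>Write the walk as \<open>x # ys @ zs\<close>. If the number of choices for \<open>zs\<close> is at most
  \<open>\<theta>\<close> times that for \<open>ys\<close>, choose \<open>ys\<close> first, so that \<open>x \<in> set ys\<close> has at most \<open>k\<close> values;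
  otherwise choose \<open>zs\<close> first and enter \<open>ys\<close> through one of the at most \<open>\<Delta>\<close> neighbours of \<open>x\<close>.\<close>

lemma card_bad_walks:
  assumes k: "k \<ge> 1" and th: "\<theta> > 0"
    and deg: "\<And>v. v \<in> V \<Longrightarrow> real (card (A `` {v})) \<le> \<Delta>"
  shows "real (card (bad_walks k)) \<le> real k * \<theta> * hom_count (k - 1) + \<Delta> / \<theta> * hom_count k"
proof -
  define B1 where "B1 = (\<Union>u\<in>V. \<Union>v\<in>V. \<Union>ys\<in>walks (k - 1) u v.
    \<Union>x\<in>{x \<in> set ys. nwalks k v x \<le> \<theta> * nwalks (k - 1) u v}.
      (\<lambda>t. x # ys @ butlast (tl t)) ` walks k v x)"
  define B2 where "B2 = (\<Union>x\<in>V. \<Union>v\<in>V. \<Union>t\<in>walks k v x.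
    \<Union>u\<in>{u \<in> A `` {x}. nwalks (k - 1) u v \<le> nwalks k v x / \<theta>}.
      (\<lambda>ys. x # ys @ butlast (tl t)) ` walks (k - 1) u v)"
  have "bad_walks k \<subseteq> B1 \<union> B2"
  proof
    fix xs assume xs: "xs \<in> bad_walks k"
    then have "xs \<in> closed_walks (2 * k)" by (simp add: bad_walks_def)
    from closed_walk_split[OF this k] obtain x ys t where s: "xs = x # ys @ butlast (tl t)" "x \<in> V"
      "ys \<in> walks (k - 1) (hd ys) (last ys)" "t \<in> walks k (last ys) x" "(x, hd ys) \<in> A"
      "hd ys \<in> V" "last ys \<in> V" "ys = take k (tl xs)" .
    have "hd xs \<in> set ys" using xs unfolding s(8) by (simp add: bad_walks_def)
    then have x: "x \<in> set ys" by (simp add: s(1))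
    show "xs \<in> B1 \<union> B2"
    proof (cases "nwalks k (last ys) x \<le> \<theta> * nwalks (k - 1) (hd ys) (last ys)")
      case True
      then have "x # ys @ butlast (tl t) \<in> B1" unfolding B1_def
        using s(6,7,3,4) x by (intro UN_I[where a = "hd ys"] UN_I[where a = "last ys"] UN_I[where a = ys] UN_I[where a = x] imageI) auto
      then have "xs \<in> B1" using s(1) by simp
      then show ?thesis by simp
    next
      case False
      then have "nwalks (k - 1) (hd ys) (last ys) \<le> nwalks k (last ys) x / \<theta>"
        using th by (simp add: field_simps)
      then have "x # ys @ butlast (tl t) \<in> B2" unfolding B2_def
        using s(2-7) by (intro UN_I[where a = x] UN_I[where a = "last ys"] UN_I[where a = t] UN_I[where a = "hd ys"] imageI) auto
      then have "xs \<in> B2" using s(1) by simp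
      then show ?thesis by simp
    qed
  qed
  moreover have "finite B1" "finite B2"
    unfolding B1_def B2_def
    by (intro finite_UN_I finV finite_walks finite_imageI finite_subset[OF Collect_restrict]
        finite_set fin_nbs)+
  ultimately have "card (bad_walks k) \<le> card B1 + card B2"
    by (meson card_Un_le card_mono finite_UnI le_trans)
  moreover have "real (card B1) \<le> (\<Sum>u\<in>V. \<Sum>v\<in>V. \<Sum>ys\<in>walks (k - 1) u v.
      real k * (\<theta> * nwalks (k - 1) u v))"
    unfolding B1_def
  proof (intro card_UN_le_sum finV finite_walks)
    fix u v ys assume ys: "ys \<in> walks (k - 1) u v"
    let ?X = "{x \<in> set ys. nwalks k v x \<le> \<theta> * nwalks (k - 1) u v}"
    have "real (card (\<Union>x\<in>?X. (\<lambda>t. x # ys @ butlast (tl t)) ` walks k v x))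
      \<le> (\<Sum>x\<in>?X. \<theta> * nwalks (k - 1) u v)"
    proof (intro card_UN_le_sum)
      fix x assume "x \<in> ?X"
      then show "real (card ((\<lambda>t. x # ys @ butlast (tl t)) ` walks k v x)) \<le> \<theta> * nwalks (k - 1) u v"
        using card_image_le[OF finite_walks, of "\<lambda>t. x # ys @ butlast (tl t)" k v x]
        by (auto simp: nwalks_def)
    qed auto
    also have "\<dots> = real (card ?X) * (\<theta> * nwalks (k - 1) u v)" by simp
    also have "card ?X \<le> card (set ys)" by (rule card_mono) auto
    then have "card ?X \<le> k" using card_length[of ys] ys k by (simp add: walks_def)
    then have "real (card ?X) * (\<theta> * nwalks (k - 1) u v) \<le> real k * (\<theta> * nwalks (k - 1) u v)"
      using th nwalks_nonneg[of "k - 1" u v] by (intro mult_right_mono) auto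
    finally show "real (card (\<Union>x\<in>?X. (\<lambda>t. x # ys @ butlast (tl t)) ` walks k v x))
      \<le> real k * (\<theta> * nwalks (k - 1) u v)" .
  qed
  \<comment> \<open>There are \<open>nwalks (k - 1) u v\<close> choices of \<open>ys\<close>, so the
    innermost sum squares this number and \<open>hom_count\<close> appears.\<close>
  moreover have "(\<Sum>u\<in>V. \<Sum>v\<in>V. \<Sum>ys\<in>walks (k - 1) u v. real k * (\<theta> * nwalks (k - 1) u v))
      = real k * \<theta> * hom_count (k - 1)"
    by (simp add: hom_count_def nwalks_def[symmetric] power2_eq_square sum_distrib_left algebra_simps)
  moreover have "real (card B2) \<le> (\<Sum>x\<in>V. \<Sum>v\<in>V. \<Sum>t\<in>walks k v x. \<Delta> * (nwalks k v x / \<theta>))"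
    unfolding B2_def
  proof (intro card_UN_le_sum finV finite_walks)
    fix x v t assume x: "x \<in> V"
    let ?U = "{u \<in> A `` {x}. nwalks (k - 1) u v \<le> nwalks k v x / \<theta>}"
    have "real (card (\<Union>u\<in>?U. (\<lambda>ys. x # ys @ butlast (tl t)) ` walks (k - 1) u v))
      \<le> (\<Sum>u\<in>?U. nwalks k v x / \<theta>)"
    proof (intro card_UN_le_sum)
      fix u assume "u \<in> ?U"
      then show "real (card ((\<lambda>ys. x # ys @ butlast (tl t)) ` walks (k - 1) u v)) \<le> nwalks k v x / \<theta>"
        using card_image_le[OF finite_walks, of "\<lambda>ys. x # ys @ butlast (tl t)" "k - 1" u v]
        by (auto simp: nwalks_def)
    qed (rule finite_subset[OF Collect_restrict fin_nbs])
    also have "\<dots> = real (card ?U) * (nwalks k v x / \<theta>)" by simp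
    also have "card ?U \<le> card (A `` {x})" by (rule card_mono) (auto simp: fin_nbs)
    then have "real (card ?U) \<le> \<Delta>" using deg[OF x] by linarith
    then have "real (card ?U) * (nwalks k v x / \<theta>) \<le> \<Delta> * (nwalks k v x / \<theta>)"
      using th nwalks_nonneg[of k v x] by (intro mult_right_mono) auto
    finally show "real (card (\<Union>u\<in>?U. (\<lambda>ys. x # ys @ butlast (tl t)) ` walks (k - 1) u v))
      \<le> \<Delta> * (nwalks k v x / \<theta>)" .
  qed
  moreover have "(\<Sum>x\<in>V. \<Sum>v\<in>V. \<Sum>t\<in>walks k v x. \<Delta> * (nwalks k v x / \<theta>)) = \<Delta> / \<theta> * hom_count k"
    by (simp add: hom_count_def nwalks_def[symmetric] power2_eq_square sum_distrib_left
        algebra_simps nwalks_sym[of k _ "_::'a"])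
  ultimately show ?thesis by linarith
qed

lemma rotate_closed_walk:
  assumes "xs \<in> closed_walks l"
  shows "rotate i xs \<in> closed_walks l"
proof -
  have step: "rotate1 xs \<in> closed_walks l" if "xs \<in> closed_walks l" for xs
  proof (cases xs)
    case (Cons x ys)
    then show ?thesis
      using that by (cases ys rule: rev_cases)
        (auto simp: closed_walks_def successively_append_iff successively_Cons hd_append)
  qed (use that in auto)
  show ?thesis by (induction i) (auto simp: assms step)
qed

text \<open>Two equal entries are at most \<open>k\<close> apart in one of the two cyclic
  directions. Rotating the one that starts this short arc to the front gives a member of
  \<open>bad_walks k\<close>, and there are \<open>2 * k\<close> rotations to undo.\<close>

lemma card_degenerate_walks:
  assumes k: "k \<ge> 1"
  shows "card {xs \<in> closed_walks (2 * k). \<not> distinct xs} \<le> 2 * k * card (bad_walks k)"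
proof -
  have fin: "finite (bad_walks k)"
    using card_closed_walks(1)[of "2 * k"] k by (simp add: bad_walks_def)
  have "{xs \<in> closed_walks (2 * k). \<not> distinct xs} \<subseteq> (\<Union>s<2 * k. rotate s ` bad_walks k)"
  proof clarify
    fix xs assume xs: "xs \<in> closed_walks (2 * k)" "\<not> distinct xs"
    have len: "length xs = 2 * k" using xs by (simp add: closed_walks_def)
    have key: "\<exists>s<2*k. xs \<in> rotate s ` bad_walks k"
      if i: "i < 2 * k" and d: "d \<ge> 1" "d \<le> k" and eq: "xs ! i = xs ! ((i + d) mod (2 * k))" for i d
    proof -
      let ?ys = "rotate i xs"
      have ys: "?ys \<in> closed_walks (2 * k)" by (rule rotate_closed_walk[OF xs(1)])
      have ne: "xs \<noteq> []" using len k by auto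
      have "hd ?ys = ?ys ! 0" using ne by (simp add: hd_conv_nth)
      also have "\<dots> = xs ! i" using len k i by (subst nth_rotate) auto
      also have "\<dots> = ?ys ! d" using len k i d eq by (subst nth_rotate) (auto simp: add.commute)
      also have "\<dots> = take k (tl ?ys) ! (d - 1)"
        using len d by (simp add: nth_tl)
      also have "\<dots> \<in> set (take k (tl ?ys))"
        using len d by (intro nth_mem) auto
      finally have "?ys \<in> bad_walks k" using ys by (simp add: bad_walks_def)
      \<comment> \<open>For \<open>i = 0\<close> the inverse rotation would be by
        \<open>2 * k\<close>, hence the reduction modulo \<open>2 * k\<close>.\<close>
      moreover have "xs = rotate ((2 * k - i) mod (2 * k)) ?ys"
        using i len rotate_rotate[of "2 * k - i" i xs] rotate_conv_mod[of "2 * k - i" ?ys] by simp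
      moreover have "(2 * k - i) mod (2 * k) < 2 * k" using k by simp
      ultimately show ?thesis by blast
    qed
    obtain i j where ij: "i < j" "j < 2 * k" "xs ! i = xs ! j"
      using xs(2) len by (metis distinct_conv_nth linorder_neqE_nat)
    have "\<exists>s<2*k. xs \<in> rotate s ` bad_walks k"
    proof (cases "j - i \<le> k")
      case True
      then show ?thesis using key[of i "j - i"] ij by auto
    next
      case False
      \<comment> \<open>The way round from \<open>j\<close> forward to \<open>i\<close> has length
        between 1 and \<open>k - 1\<close> here.\<close>
      then have "(j + (2 * k - (j - i))) mod (2 * k) = i" using ij by simp
      then show ?thesis using key[of j "2 * k - (j - i)"] ij False by auto
    qed
    then show "xs \<in> (\<Union>s<2 * k. rotate s ` bad_walks k)" by blast
  qed
  then have "card {xs \<in> closed_walks (2 * k). \<not> distinct xs} \<le> card (\<Union>s<2 * k. rotate s ` bad_walks k)"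
    using fin by (intro card_mono) auto
  also have "\<dots> \<le> (\<Sum>s<2 * k. card (rotate s ` bad_walks k))" by (rule card_UN_le) auto
  also have "\<dots> \<le> (\<Sum>s<2 * k. card (bad_walks k))" by (intro sum_mono card_image_le fin)
  finally show ?thesis by simp
qed

text \<open>In the application \<open>L w\<close> consists of the steps whose hyperedge contains the vertex \<open>w\<close>,
  so a walk with all steps in \<open>L w\<close> is one that gives a trivial Berge cycle.\<close>

lemma exists_distinct_closed_walk:
  assumes k: "k \<ge> 1" and ne: "V \<noteq> {}" and d: "d > 0" and D: "\<Delta> > 0"
    and mindeg: "\<And>v. v \<in> V \<Longrightarrow> d \<le> real (card (A `` {v}))"
    and maxdeg: "\<And>v. v \<in> V \<Longrightarrow> real (card (A `` {v})) \<le> \<Delta>"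
    and W: "finite W" and L: "\<And>w. w \<in> W \<Longrightarrow> L w \<subseteq> A \<and> real (card (L w)) \<le> 2 * \<Delta>"
    and n: "card V \<le> n" "card W \<le> n"
    and large: "real n * (64 * real k ^ 3 * \<Delta>) ^ k < d ^ (2 * k)"
  shows "\<exists>xs \<in> closed_walks (2 * k). distinct xs \<and>
    (\<forall>w\<in>W. \<exists>i<2 * k - 1. (xs ! i, xs ! Suc i) \<notin> L w)"
proof (rule ccontr)
  assume contra: "\<not> ?thesis"
  let ?C = "closed_walks (2 * k)"
  let ?D = "{xs \<in> ?C. \<not> distinct xs}"
  let ?S = "\<lambda>w. {xs. length xs = 2 * k \<and> (\<forall>i<2 * k - 1. (xs ! i, xs ! Suc i) \<in> L w)}"
  have finC: "finite ?C" using card_closed_walks(1)[of "2 * k"] k by simp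
  have finL: "finite (L w)" if "w \<in> W" for w using L[OF that] finA finite_subset by blast
  \<comment> \<open>Under the negated claim every closed walk repeats a vertex or has all its listed
    steps in a single \<open>L w\<close>.\<close>
  have "?C \<subseteq> ?D \<union> (\<Union>w\<in>W. ?S w)"
    using contra by (auto simp: closed_walks_def)
  moreover have "finite (\<Union>w\<in>W. ?S w)"
    using W card_lists_pairs_le(1)[OF finL] by auto
  moreover have "finite ?D" using finC by (rule rev_finite_subset) blast
  ultimately have "card ?C \<le> card (?D \<union> (\<Union>w\<in>W. ?S w))"
    by (intro card_mono finite_UnI)
  also have "\<dots> \<le> card ?D + card (\<Union>w\<in>W. ?S w)" by (rule card_Un_le)
  finally have "card ?C \<le> card ?D + card (\<Union>w\<in>W. ?S w)" .
  moreover have "real (card (\<Union>w\<in>W. ?S w)) \<le> (\<Sum>w\<in>W. (2 * \<Delta>) ^ k)"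
  proof (rule card_UN_le_sum[OF W])
    fix w assume w: "w \<in> W"
    have "real (card (?S w)) \<le> real (card (L w) ^ k)"
      using card_lists_pairs_le(2)[OF finL[OF w], of k] by (rule of_nat_mono)
    also have "\<dots> = real (card (L w)) ^ k" by simp
    also have "\<dots> \<le> (2 * \<Delta>) ^ k" using L[OF w] by (intro power_mono) auto
    finally show "real (card (?S w)) \<le> (2 * \<Delta>) ^ k" .
  qed
  moreover have "(\<Sum>w\<in>W. (2 * \<Delta>) ^ k) \<le> real n * (2 * \<Delta>) ^ k"
    using n D by (simp add: mult_right_mono)
  moreover have H: "hom_count k = real (card ?C)"
    using card_closed_walks(2)[of "2 * k"] k by (simp add: hom_count_eq)
  ultimately have 1: "hom_count k \<le> real (card ?D) + real n * (2 * \<Delta>) ^ k"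
    by linarith
  \<comment> \<open>This choice makes \<open>2 * k * \<Delta> / \<theta> = 1 / 4\<close>, so the
    second term of \<open>card_bad_walks\<close> absorbs only a quarter of all closed walks.\<close>
  define \<theta> where "\<theta> = 8 * real k * \<Delta>"
  have th: "\<theta> > 0" using k D by (simp add: \<theta>_def)
  have "real (card ?D) \<le> 2 * real k * real (card (bad_walks k))"
    using of_nat_mono[OF card_degenerate_walks[OF k], where 'a = real] by simp
  also have "\<dots> \<le> 2 * real k * (real k * \<theta> * hom_count (k - 1) + \<Delta> / \<theta> * hom_count k)"
    using card_bad_walks[OF k th maxdeg] by (intro mult_left_mono) auto
  also have "\<dots> = 16 * real k ^ 3 * \<Delta> * hom_count (k - 1) + hom_count k / 4"
    using k D by (simp add: \<theta>_def field_simps power3_eq_cube)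
  finally have 2: "real (card ?D) \<le> 16 * real k ^ 3 * \<Delta> * hom_count (k - 1) + hom_count k / 4" .
  have low: "d ^ (2 * k) \<le> hom_count k"
    using hom_count_ge[of d k] d mindeg ne by simp
  then have pos: "hom_count k > 0" using d by (meson less_le_trans zero_less_power)
  have kk: "Suc (k - 1) = k" using k by simp
  \<comment> \<open>Otherwise \<open>hom_count_ratio\<close> and \<open>large\<close> would push
    \<open>hom_count k\<close> below its lower bound \<open>d ^ (2 * k)\<close>. Hence the first
    term of \<open>card_bad_walks\<close> absorbs less than another quarter.\<close>
  have 3: "64 * real k ^ 3 * \<Delta> * hom_count (k - 1) < hom_count k"
  proof (rule ccontr)
    assume "\<not> ?thesis"
    then have "hom_count k \<le> (64 * real k ^ 3 * \<Delta>) ^ k * real (card V)"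
      using hom_count_ratio[of "64 * real k ^ 3 * \<Delta>" "k - 1"] pos D unfolding kk hom_count_0 by simp
    also have "\<dots> \<le> real n * (64 * real k ^ 3 * \<Delta>) ^ k"
      using n D by (simp add: mult.commute mult_right_mono)
    finally show False using large low by linarith
  qed
  \<comment> \<open>The constant \<open>64 = 32 * 2\<close> leaves for the trivial walks less than a
    32nd part of all closed walks, so the three shares together stay below one.\<close>
  have "real k ^ 3 \<ge> 1" using k by simp
  then have "32 * (2 * \<Delta>) \<le> 64 * real k ^ 3 * \<Delta>"
    using D by (simp add: mult_right_mono)
  then have "(32 * (2 * \<Delta>)) ^ k \<le> (64 * real k ^ 3 * \<Delta>) ^ k" using D by (intro power_mono) auto
  moreover have "(32::real) ^ k \<ge> 32 ^ 1" using k by (intro power_increasing) auto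
  then have "32 * (2 * \<Delta>) ^ k \<le> (32 * (2 * \<Delta>)) ^ k"
    using D unfolding power_mult_distrib[of 32] by (intro mult_right_mono) auto
  ultimately have "32 * (2 * \<Delta>) ^ k \<le> (64 * real k ^ 3 * \<Delta>) ^ k" by linarith
  then have "real n * (32 * (2 * \<Delta>) ^ k) \<le> real n * (64 * real k ^ 3 * \<Delta>) ^ k"
    by (intro mult_left_mono) auto
  then have "32 * (real n * (2 * \<Delta>) ^ k) < hom_count k" using large low by linarith
  moreover have "real n * (2 * \<Delta>) ^ k \<ge> 0" using D by simp
  ultimately show False using 1 2 3 by linarith
qed

end

section \<open>Berge cycles from graph cycles\<close>

lemma nontrivial_berge_cycleI:
  assumes m: "m > 0" and xs: "length xs = m" "distinct xs" and inj: "inj_on e {..<m}"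
    and mem: "\<And>i. i < m \<Longrightarrow> xs ! i \<in> e i" "\<And>i. i < m \<Longrightarrow> xs ! (Suc i mod m) \<in> e i"
    and card: "\<And>i. i < m \<Longrightarrow> card (e i) = 3"
    and triv: "\<And>x. \<exists>i<m. x \<notin> e i"
  shows "e ` {..<m} \<in> nontrivial_berge_cycles m"
proof -
  \<comment> \<open>Entry \<open>i + 1\<close> of the list, read cyclically, lies in both edge
    \<open>i\<close> and edge \<open>i + 1\<close>, so the representatives are shifted by
    one.\<close>
  define r where "r i = xs ! (Suc i mod m)" for i
  have "inj_on r {..<m}"
  proof (rule inj_onI)
    fix i j assume ij: "i \<in> {..<m}" "j \<in> {..<m}" "r i = r j"
    then have "Suc i mod m = Suc j mod m"
      using xs m by (simp add: r_def nth_eq_iff_index_eq)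
    then show "i = j"
      using ij by (metis lessThan_iff mod_Suc mod_less nat.distinct(1) nat.inject)
  qed
  moreover have "r i \<in> e i \<inter> e (Suc i mod m)" if "i < m" for i
    using mem(2)[OF that] mem(1)[of "Suc i mod m"] m by (simp add: r_def)
  ultimately have "berge_cycle m e" using inj unfolding berge_cycle_def by blast
  moreover have "(\<Inter>i<m. e i) = {}" using triv by fastforce
  ultimately show ?thesis using card unfolding nontrivial_berge_cycles_def by blast
qed

section \<open>Greedy embedding under large codegrees\<close>

definition full_codegrees :: "nat \<Rightarrow> 'a set set \<Rightarrow> bool" where
  "full_codegrees d F \<longleftrightarrow>
    (\<forall>f\<in>F. \<forall>x\<in>f. \<forall>y\<in>f. x \<noteq> y \<longrightarrow> d \<le> card {g \<in> F. {x, y} \<subseteq> g})"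

text \<open>Distinct edges through \<open>x\<close> and \<open>y\<close> have distinct third
  vertices, so fewer than \<open>d\<close> forbidden vertices cannot block all of them.\<close>

lemma full_codegreesD:
  assumes "full_codegrees d F" "\<And>f. f \<in> F \<Longrightarrow> card f = 3"
    and "f \<in> F" "x \<in> f" "y \<in> f" "x \<noteq> y" and S: "finite S" "card S < d"
  obtains z where "{x, y, z} \<in> F" "z \<notin> S" "z \<noteq> x" "z \<noteq> y"
proof -
  have "d \<le> card {g \<in> F. {x, y} \<subseteq> g}" using assms unfolding full_codegrees_def by blast
  also have "card {g \<in> F. {x, y} \<subseteq> g} \<le> card ((\<lambda>z. {x, y, z}) ` S)"
    if no: "\<not> (\<exists>z. {x, y, z} \<in> F \<and> z \<notin> S \<and> z \<noteq> x \<and> z \<noteq> y)"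
  proof (rule card_mono)
    show "{g \<in> F. {x, y} \<subseteq> g} \<subseteq> (\<lambda>z. {x, y, z}) ` S"
    proof clarify
      fix g assume g: "g \<in> F" "{x, y} \<subseteq> g"
      have "card (g - {x, y}) = 1"
        using g assms(2)[OF g(1)] \<open>x \<noteq> y\<close> by (subst card_Diff_subset) auto
      then obtain z where "g - {x, y} = {z}" by (auto simp: card_1_singleton_iff)
      then have "g = {x, y, z}" "z \<noteq> x" "z \<noteq> y" using g by auto
      then show "g \<in> (\<lambda>z. {x, y, z}) ` S" using no g by auto
    qed
  qed (use S in auto)
  ultimately show ?thesis
    using that S card_image_le[OF S(1), of "\<lambda>z. {x, y, z}"] by fastforce
qed

text \<open>A path of \<open>m - 1\<close> vertices in the link of \<open>v\<close> closes up
  through \<open>v\<close> to a cycle of covered pairs, and each pair is then completed by a new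
  vertex. Fewer than \<open>2 * m\<close> vertices are forbidden at any time: the \<open>m\<close>
  on the cycle and the new ones chosen before.\<close>

lemma full_codegrees_cycle:
  assumes m: "m \<ge> 3" and full: "full_codegrees (2 * m) F" and F: "F \<noteq> {}"
    and card3: "\<And>f. f \<in> F \<Longrightarrow> card f = 3"
  shows "\<exists>H\<in>nontrivial_berge_cycles m. H \<subseteq> F"
proof -
  note fresh = full_codegreesD[OF full card3]
  obtain v a b where vab: "{v, a, b} \<in> F" "v \<noteq> a" "v \<noteq> b" "a \<noteq> b"
    using F card3 card_3_iff by (metis ex_in_conv)
  have path: "\<exists>xs. length xs = l + 2 \<and> distinct xs \<and> v \<notin> set xs \<and>
      successively (\<lambda>x y. {v, x, y} \<in> F) xs" if "l + 2 < m" for l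
    using that
  proof (induction l)
    case 0
    show ?case using vab by (intro exI[of _ "[a, b]"]) auto
  next
    case (Suc l)
    then obtain xs where xs: "length xs = l + 2" "distinct xs" "v \<notin> set xs"
      "successively (\<lambda>x y. {v, x, y} \<in> F) xs" by auto
    then obtain p q ys where eq: "xs = p # q # ys" by (auto simp: length_Suc_conv)
    have "card (insert v (set xs)) < 2 * m"
      using xs Suc.prems by (simp add: distinct_card)
    moreover have "{v, p, q} \<in> F" "v \<noteq> p" using xs eq by auto
    \<comment> \<open>The path grows at its head: the pair of \<open>v\<close> and \<open>p\<close>
      is covered, by the link edge that joins \<open>p\<close> to \<open>q\<close>.\<close>
    ultimately obtain z where "{v, p, z} \<in> F" "z \<notin> insert v (set xs)"
      using fresh[of "{v, p, q}" v p "insert v (set xs)"] by auto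
    then show ?case using xs eq
      by (intro exI[of _ "z # xs"]) (auto simp: insert_commute)
  qed
  obtain xs where xs: "length xs = m - 1" "distinct xs" "v \<notin> set xs"
    "successively (\<lambda>x y. {v, x, y} \<in> F) xs"
  proof -
    have "m - 3 + 2 < m" "m - 3 + 2 = m - 1" using m by auto
    then show ?thesis using path[of "m - 3"] that by auto
  qed
  have link: "{v, xs ! i, xs ! Suc i} \<in> F" if "Suc i < m - 1" for i
    using xs(4) that xs(1) successively_nth[of "\<lambda>x y. {v, x, y} \<in> F" xs i] by auto
  define cs where "cs = v # xs"
  have cs: "length cs = m" "distinct cs" using xs m by (auto simp: cs_def)
  define s where "s i = Suc i mod m" for i
  have s: "s i < m" "i < m \<Longrightarrow> s i = (if Suc i = m then 0 else Suc i)" for i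
    using m by (auto simp: s_def)
  have ne: "cs ! i \<noteq> cs ! s i" if "i < m" for i
    using cs s[of i] that m by (auto simp: nth_eq_iff_index_eq split: if_splits)
  \<comment> \<open>Pairs inside the path are covered by their link edges, and the two pairs at
    \<open>v\<close> by the first and the last link edge.\<close>
  have cov: "\<exists>f\<in>F. cs ! i \<in> f \<and> cs ! s i \<in> f" if i: "i < m" for i
  proof -
    consider "i = 0" | "Suc i = m" | "0 < i" "Suc i < m" using i by linarith
    then show ?thesis
    proof cases
      case 1
      then have "s i = Suc 0" using s(2)[OF i] m by simp
      then have "cs ! s i = xs ! 0" by (simp add: cs_def)
      moreover have "cs ! i = v" using 1 by (simp add: cs_def)
      moreover have "{v, xs ! 0, xs ! Suc 0} \<in> F" using m by (intro link) simp
      ultimately show ?thesis by (intro bexI[of _ "{v, xs ! 0, xs ! Suc 0}"]) simp_all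
    next
      case 2
      define l where "l = m - 3"
      have ml: "m = Suc (Suc (Suc l))" using m by (simp add: l_def)
      then have "i = Suc (Suc l)" using 2 by simp
      then have "cs ! i = xs ! Suc l" by (simp add: cs_def)
      moreover have "cs ! s i = v" using 2 s(2)[OF i] by (simp add: cs_def)
      moreover have "{v, xs ! l, xs ! Suc l} \<in> F" by (rule link) (simp add: ml)
      ultimately show ?thesis by (intro bexI[of _ "{v, xs ! l, xs ! Suc l}"]) simp_all
    next
      case 3
      then obtain l where l: "i = Suc l" using gr0_implies_Suc by blast
      then have "cs ! i = xs ! l" "cs ! s i = xs ! Suc l"
        using s(2)[OF i] 3 by (simp_all add: cs_def)
      moreover have "{v, xs ! l, xs ! Suc l} \<in> F" using 3 l by (intro link) simp
      ultimately show ?thesis by (intro bexI[of _ "{v, xs ! l, xs ! Suc l}"]) simp_all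
    qed
  qed
  have "\<exists>w. inj_on w {..<j} \<and> (\<forall>i<j. {cs ! i, cs ! s i, w i} \<in> F \<and> w i \<notin> set cs)"
    if "j \<le> m" for j
    using that
  proof (induction j)
    case (Suc j)
    then obtain w where w: "inj_on w {..<j}" "\<And>i. i < j \<Longrightarrow> {cs ! i, cs ! s i, w i} \<in> F \<and> w i \<notin> set cs"
      by auto
    let ?S = "set cs \<union> w ` {..<j}"
    have "card ?S \<le> card (set cs) + card (w ` {..<j})" by (rule card_Un_le)
    also have "\<dots> < 2 * m"
      using Suc.prems cs card_image_le[of "{..<j}" w] by (simp add: distinct_card)
    finally have "card ?S < 2 * m" .
    have j: "j < m" using Suc.prems by simp
    obtain f where f: "f \<in> F" "cs ! j \<in> f" "cs ! s j \<in> f" using cov[OF j] by blast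
    obtain z where z: "{cs ! j, cs ! s j, z} \<in> F" "z \<notin> ?S"
      by (rule fresh[OF _ f ne[OF j] _ \<open>card ?S < 2 * m\<close>]) auto
    show ?case
    proof (intro exI[of _ "w(j := z)"] conjI allI impI)
      show "inj_on (w(j := z)) {..<Suc j}"
        using w(1) z(2) by (auto simp: lessThan_Suc inj_on_def)
    qed (use w z in \<open>auto simp: less_Suc_eq\<close>)
  qed auto
  then obtain w where w: "inj_on w {..<m}" "\<And>i. i < m \<Longrightarrow> {cs ! i, cs ! s i, w i} \<in> F"
    "\<And>i. i < m \<Longrightarrow> w i \<notin> set cs" by blast
  define e where "e i = {cs ! i, cs ! s i, w i}" for i
  \<comment> \<open>Each new vertex lies only in its own edge, each cycle vertex only in the two
    edges that meet there.\<close>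
  have we: "w i \<in> e j \<longleftrightarrow> i = j" if "i < m" "j < m" for i j
    using w(1,3) that cs s(1)[of j] by (auto simp: e_def inj_on_def) (metis nth_mem)+
  have ce: "cs ! i \<in> e j \<longleftrightarrow> i = j \<or> i = s j" if "i < m" "j < m" for i j
    using w(3) that cs s(1)[of j] by (auto simp: e_def nth_eq_iff_index_eq) (metis nth_mem)+
  have "e ` {..<m} \<in> nontrivial_berge_cycles m"
  proof (rule nontrivial_berge_cycleI[OF _ cs])
    show "inj_on e {..<m}" using we by (intro inj_onI) (metis lessThan_iff)
    show "cs ! i \<in> e i" "cs ! (Suc i mod m) \<in> e i" for i by (auto simp: e_def s_def)
    show "card (e i) = 3" if "i < m" for i using card3 w(2)[OF that] by (simp add: e_def)
    show "\<exists>i<m. x \<notin> e i" for x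
    proof (rule ccontr)
      assume "\<not> ?thesis"
      then have all: "x \<in> e i" if "i < m" for i using that by auto
      show False
      proof (cases "x \<in> set cs")
        case True
        then obtain i where i: "i < m" "x = cs ! i" using cs by (metis in_set_conv_nth)
        \<comment> \<open>The edge after \<open>e i\<close> misses \<open>cs ! i\<close>: its cycle
          vertices are the next two, which differ from it because \<open>m \<ge> 3\<close>.\<close>
        then have "cs ! i \<in> e (s i)" using all s(1) by auto
        then have "i = s i \<or> i = s (s i)" using ce[OF i(1) s(1)] by auto
        then show False using s(2)[OF i(1)] s(2)[OF s(1)[of i]] i m by (auto split: if_splits)
      next
        case False
        have "x = w i" if "i < m" for i
          using all[OF that] False cs(1) s(1)[of i] that nth_mem[of i cs] nth_mem[of "s i" cs]
          unfolding e_def by auto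
        from this[of 0] this[of 1] have "w 0 = w 1" using m by simp
        then show False using inj_onD[OF w(1), of 0 1] m by simp
      qed
    qed
  qed (use m in auto)
  moreover have "e ` {..<m} \<subseteq> F" using w(2) by (auto simp: e_def)
  ultimately show ?thesis by blast
qed

text \<open>Take a covered pair of codegree below \<open>d\<close>, assign it to all edges
  containing it, delete them and repeat. No remaining edge contains that pair, so its fibre never
  grows again.\<close>

lemma light_pair_assignment:
  assumes "finite E" and no: "\<And>F. F \<subseteq> E \<Longrightarrow> F \<noteq> {} \<Longrightarrow> \<not> full_codegrees d F"
  shows "\<exists>\<phi>. (\<forall>e\<in>E. \<phi> e \<subseteq> e \<and> card (\<phi> e) = 2) \<and> (\<forall>p. card {e \<in> E. \<phi> e = p} \<le> d)"
  using assms
proof (induction "card E" arbitrary: E rule: less_induct)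
  case less
  show ?case
  proof (cases "E = {}")
    case False
    then obtain f x y where f: "f \<in> E" "x \<in> f" "y \<in> f" "x \<noteq> y" "card {g \<in> E. {x, y} \<subseteq> g} < d"
      using less.prems(2)[of E] unfolding full_codegrees_def by (auto simp: not_le)
    define E' where "E' = {g \<in> E. \<not> {x, y} \<subseteq> g}"
    have "card E' < card E"
      using f less.prems(1) by (intro psubset_card_mono) (auto simp: E'_def)
    moreover have "finite E'" using less.prems(1) by (simp add: E'_def)
    moreover have "\<not> full_codegrees d F" if "F \<subseteq> E'" "F \<noteq> {}" for F
      using that less.prems(2)[of F] by (auto simp: E'_def)
    ultimately obtain \<phi> where \<phi>: "\<And>e. e \<in> E' \<Longrightarrow> \<phi> e \<subseteq> e \<and> card (\<phi> e) = 2"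
      "\<And>p. card {e \<in> E'. \<phi> e = p} \<le> d"
      using less.hyps[of E'] by blast
    define \<psi> where "\<psi> e = (if {x, y} \<subseteq> e then {x, y} else \<phi> e)" for e
    have "\<psi> e \<subseteq> e \<and> card (\<psi> e) = 2" if "e \<in> E" for e
      using \<phi>(1)[of e] that f(4) by (auto simp: \<psi>_def E'_def)
    moreover have "card {e \<in> E. \<psi> e = p} \<le> d" for p
    proof (cases "p = {x, y}")
      case True
      have "{e \<in> E. \<psi> e = p} \<subseteq> {g \<in> E. {x, y} \<subseteq> g}"
        using \<phi>(1) True by (auto simp: \<psi>_def E'_def split: if_splits)
      then have "card {e \<in> E. \<psi> e = p} \<le> card {g \<in> E. {x, y} \<subseteq> g}"
        using less.prems(1) by (intro card_mono) auto
      then show ?thesis using f(5) by linarith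
    next
      case False
      then have "{e \<in> E. \<psi> e = p} \<subseteq> {e \<in> E'. \<phi> e = p}"
        by (auto simp: \<psi>_def E'_def split: if_splits)
      then have "card {e \<in> E. \<psi> e = p} \<le> card {e \<in> E'. \<phi> e = p}"
        using less.prems(1) by (intro card_mono) (auto simp: E'_def)
      then show ?thesis using \<phi>(2)[of p] by linarith
    qed
    ultimately show ?thesis by blast
  qed auto
qed

text \<open>Among the nonempty vertex sets that span at least as many ordered pairs per vertex as
  the whole graph, take a smallest one: deleting a vertex of degree below half the original average
  would keep this density.\<close>

lemma min_degree_subgraph:
  assumes V: "finite V" and A: "A \<subseteq> V \<times> V" "sym A" "irrefl A" "A \<noteq> {}"
  shows "\<exists>U\<subseteq>V. U \<noteq> {} \<and>
    (\<forall>v\<in>U. real (card A) / (2 * real (card V)) \<le> real (card ((A \<inter> U \<times> U) `` {v})))"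
proof -
  have finA: "finite A" using V A(1) finite_subset by blast
  have "V \<noteq> {}" using A by auto
  then have Vp: "real (card V) > 0" using V by (simp add: card_gt_0_iff)
  define c where "c = real (card A) / (2 * real (card V))"
  have "c > 0" using Vp A(4) finA by (simp add: c_def card_gt_0_iff)
  define P where "P U \<longleftrightarrow> U \<subseteq> V \<and> U \<noteq> {} \<and> 2 * c * real (card U) \<le> real (card (A \<inter> U \<times> U))" for U
  have "P V" using \<open>V \<noteq> {}\<close> A(1) Vp by (auto simp: P_def c_def Int_absorb2)
  then obtain U where U: "P U" "\<And>U'. P U' \<Longrightarrow> card U \<le> card U'"
    using ex_has_least_nat[of P V card] by blast
  have finU: "finite U" using U(1) V finite_subset by (auto simp: P_def)
  have "c \<le> real (card ((A \<inter> U \<times> U) `` {v}))" if v: "v \<in> U" for v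
  proof (rule ccontr)
    assume low: "\<not> ?thesis"
    let ?N = "(A \<inter> U \<times> U) `` {v}"
    let ?U = "U - {v}"
    have finN: "finite ?N" using finA by auto
    have "A \<inter> U \<times> U \<subseteq> A \<inter> ?U \<times> ?U \<union> ({v} \<times> ?N \<union> ?N \<times> {v})"
      using symD[OF A(2)] by auto
    then have "card (A \<inter> U \<times> U) \<le> card (A \<inter> ?U \<times> ?U \<union> ({v} \<times> ?N \<union> ?N \<times> {v}))"
      using finA finN by (intro card_mono) auto
    also have "\<dots> \<le> card (A \<inter> ?U \<times> ?U) + card ({v} \<times> ?N \<union> ?N \<times> {v})"
      by (rule card_Un_le)
    also have "card ({v} \<times> ?N \<union> ?N \<times> {v}) \<le> card ({v} \<times> ?N) + card (?N \<times> {v})"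
      by (rule card_Un_le)
    finally have "card (A \<inter> U \<times> U) \<le> card (A \<inter> ?U \<times> ?U) + 2 * card ?N"
      by (simp add: card_cartesian_product)
    then have "2 * c * real (card U) \<le> real (card (A \<inter> ?U \<times> ?U)) + 2 * real (card ?N)"
      using U(1) by (simp add: P_def)
    then have "2 * c * real (card U) - 2 * c < real (card (A \<inter> ?U \<times> ?U))"
      using low by linarith
    moreover have cU: "real (card ?U) = real (card U) - 1" 
      using v finU card_gt_0_iff[of U] by (auto simp: card_Diff_singleton of_nat_diff)
    ultimately have gt: "2 * c * real (card ?U) < real (card (A \<inter> ?U \<times> ?U))"
      unfolding cU by (simp add: algebra_simps)
    \<comment> \<open>On the empty set the strict inequality would read
      \<open>0 < 0\<close>.\<close>
    have "?U \<noteq> {}"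
    proof
      assume "?U = {}"
      then show False using gt unfolding \<open>?U = {}\<close> by simp
    qed
    then have "P ?U" using gt U(1) by (auto simp: P_def)
    then show False using U(2)[of ?U] v finU by (metis card_Diff1_less not_le)
  qed
  then show ?thesis using U(1) unfolding P_def c_def by blast
qed

section \<open>From graph cycles back to hyperedges\<close>

lemma card_ordered_pairs:
  assumes "card p = 2"
  shows "finite {(x, y). x \<noteq> y \<and> {x, y} = p}" "card {(x, y). x \<noteq> y \<and> {x, y} = p} = 2"
proof -
  obtain a b where p: "p = {a, b}" "a \<noteq> b" using assms by (auto simp: card_2_iff)
  then have "{(x, y). x \<noteq> y \<and> {x, y} = p} = {(a, b), (b, a)}"
    by (auto simp: doubleton_eq_iff)
  then show "finite {(x, y). x \<noteq> y \<and> {x, y} = p}" "card {(x, y). x \<noteq> y \<and> {x, y} = p} = 2"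
    using p by auto
qed

lemma card_le_mult_card_image:
  assumes "finite E" "\<And>p. card {e \<in> E. \<phi> e = p} \<le> d"
  shows "card E \<le> d * card (\<phi> ` E)"
proof -
  have "E = (\<Union>p\<in>\<phi> ` E. {e \<in> E. \<phi> e = p})" by auto
  then have "card E \<le> (\<Sum>p\<in>\<phi> ` E. card {e \<in> E. \<phi> e = p})"
    using card_UN_le[of "\<phi> ` E" "\<lambda>p. {e \<in> E. \<phi> e = p}"] assms(1) by simp
  also have "\<dots> \<le> (\<Sum>p\<in>\<phi> ` E. d)" using assms(2) by (intro sum_mono) auto
  finally show ?thesis by (simp add: mult.commute)
qed

text \<open>The hyperedge \<open>ed x y\<close> was assigned the pair of \<open>x\<close> and
  \<open>y\<close>, so \<open>\<phi>\<close> recovers the pair and different pairs give different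
  hyperedges. The pairs along the cycle differ since \<open>m \<ge> 3\<close>; a cycle of length 2
  would use one pair twice.\<close>

lemma nontrivial_berge_cycle_of_closed_walk:
  assumes m: "m \<ge> 3" and xs: "length xs = m" "distinct xs"
    and step: "\<And>i. i < m \<Longrightarrow> ed (xs ! i) (xs ! (Suc i mod m)) \<in> E \<and>
      \<phi> (ed (xs ! i) (xs ! (Suc i mod m))) = {xs ! i, xs ! (Suc i mod m)}"
    and E: "\<And>e. e \<in> E \<Longrightarrow> card e = 3 \<and> \<phi> e \<subseteq> e"
    and triv: "\<And>w. \<exists>i<m. w \<notin> ed (xs ! i) (xs ! (Suc i mod m))"
  shows "\<exists>H\<in>nontrivial_berge_cycles m. H \<subseteq> E"
proof -
  define e where "e i = ed (xs ! i) (xs ! (Suc i mod m))" for i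
  have e: "e i \<in> E" "\<phi> (e i) = {xs ! i, xs ! (Suc i mod m)}" if "i < m" for i
    using step[OF that] by (auto simp: e_def)
  have "e ` {..<m} \<in> nontrivial_berge_cycles m"
  proof (rule nontrivial_berge_cycleI[OF _ xs])
    show "inj_on e {..<m}"
    proof (rule inj_onI)
      fix i j assume ij: "i \<in> {..<m}" "j \<in> {..<m}" "e i = e j"
      then have "{xs ! i, xs ! (Suc i mod m)} = {xs ! j, xs ! (Suc j mod m)}"
        using e(2) by (metis lessThan_iff)
      then have "i = j \<or> i = Suc j mod m \<and> Suc i mod m = j"
        using xs ij m by (auto simp: doubleton_eq_iff nth_eq_iff_index_eq)
      then show "i = j" using ij m by (auto simp: mod_Suc split: if_splits)
    qed
    show "xs ! i \<in> e i" "xs ! (Suc i mod m) \<in> e i" "card (e i) = 3" if "i < m" for i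
      using e[OF that] E[OF e(1)[OF that]] by auto
    show "\<exists>i<m. x \<notin> e i" for x using triv[of x] by (simp add: e_def)
  qed (use m in auto)
  moreover have "e ` {..<m} \<subseteq> E" using e(1) by auto
  ultimately show ?thesis by blast
qed

text \<open>The base on the left is a lower bound for the minimum degree in a subgraph of the
  assigned pairs, and \<open>\<Delta>\<close> bounds its maximum degree. The inequality is the
  failure of the hypothesis \<open>large\<close> of
  \<open>exists_distinct_closed_walk\<close>.\<close>

lemma edges_le_of_no_berge_cycle:
  assumes G: "three_graph V E" and k: "k \<ge> 2" and no: "\<not> (\<exists>H\<in>nontrivial_berge_cycles (2 * k). H \<subseteq> E)"
    and n: "card V \<le> n" and E: "E \<noteq> {}"
    and deg: "\<And>v. v \<in> V \<Longrightarrow> real (card {e \<in> E. v \<in> e}) \<le> \<Delta>"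
  shows "(real (card E) / (4 * real k * real n)) ^ (2 * k) \<le> real n * (64 * real k ^ 3 * \<Delta>) ^ k"
proof (rule ccontr)
  assume large: "\<not> ?thesis"
  have V: "finite V" and E3: "e \<in> E \<Longrightarrow> e \<subseteq> V \<and> card e = 3" for e
    using G by (auto simp: three_graph_def nsets_def)
  have finE: "finite E" using V E3 by (meson PowI finite_Pow_iff finite_subset subsetI)
  \<comment> \<open>The threshold \<open>4 * k\<close> is twice the cycle length
    \<open>2 * k\<close>, as \<open>full_codegrees_cycle\<close> requires.\<close>
  have "\<not> full_codegrees (4 * k) F" if "F \<subseteq> E" "F \<noteq> {}" for F
  proof
    assume "full_codegrees (4 * k) F"
    then have "\<exists>H\<in>nontrivial_berge_cycles (2 * k). H \<subseteq> F"
      using that k E3 by (intro full_codegrees_cycle) auto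
    then show False using no that(1) by blast
  qed
  from light_pair_assignment[OF finE this] obtain \<phi> where
    \<phi>: "\<And>e. e \<in> E \<Longrightarrow> \<phi> e \<subseteq> e \<and> card (\<phi> e) = 2" and fib: "\<And>p. card {e \<in> E. \<phi> e = p} \<le> 4 * k"
    by blast
  \<comment> \<open>\<open>A\<close> holds both orientations of every assigned pair, and
    \<open>ed\<close> picks one hyperedge for each pair.\<close>
  define A where "A = (\<Union>p\<in>\<phi> ` E. {(x, y). x \<noteq> y \<and> {x, y} = p})"
  define ed where "ed x y = inv_into E \<phi> {x, y}" for x y
  have ed: "ed x y \<in> E" "\<phi> (ed x y) = {x, y}" if "(x, y) \<in> A" for x y
    using that inv_into_into[of "{x, y}" \<phi> E] f_inv_into_f[of "{x, y}" \<phi> E]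
    by (auto simp: A_def ed_def)
  have ed_sub: "{x, y} \<subseteq> ed x y" if "(x, y) \<in> A" for x y
    using ed[OF that] \<phi> by metis
  have AV: "A \<subseteq> V \<times> V" using ed_sub ed(1) E3 by fastforce
  have symA: "sym A" by (auto simp: A_def sym_def insert_commute)
  have irrA: "irrefl A" by (auto simp: A_def irrefl_def)
  have "card A = (\<Sum>p\<in>\<phi> ` E. 2)"
    unfolding A_def
  proof (subst card_UN_disjoint)
    show "(\<Sum>p\<in>\<phi> ` E. card {(x, y). x \<noteq> y \<and> {x, y} = p}) = (\<Sum>p\<in>\<phi> ` E. 2)"
      using \<phi> card_ordered_pairs(2) by (intro sum.cong) blast+
  qed (use finE \<phi> card_ordered_pairs(1) in blast)+
  then have cA: "card A = 2 * card (\<phi> ` E)" by simp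
  have finA: "finite A" using AV V finite_subset by blast
  have cE: "card E > 0" using E finE by (simp add: card_gt_0_iff)
  have cEA: "card E \<le> 2 * k * card A"
    using card_le_mult_card_image[OF finE fib] cA by simp
  then have "A \<noteq> {}" using cE by auto
  with min_degree_subgraph[OF V AV symA irrA] obtain U where U: "U \<subseteq> V" "U \<noteq> {}"
    "\<And>v. v \<in> U \<Longrightarrow> real (card A) / (2 * real (card V)) \<le> real (card ((A \<inter> U \<times> U) `` {v}))"
    by blast
  define A' where "A' = A \<inter> U \<times> U"
  interpret finite_sym_rel U A'
    using U(1) V symA by unfold_locales (auto simp: A'_def sym_def finite_subset)
  \<comment> \<open>At most \<open>4 * k\<close> hyperedges share a pair and a pair gives two
    elements of \<open>A\<close>, so \<open>A\<close> has at least \<open>card E / (2 * k)\<close>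
    elements; half of its average degree is then at least \<open>d\<close>.\<close>
  define d where "d = real (card E) / (4 * real k * real n)"
  have Vp: "card V > 0" using U V card_gt_0_iff by fastforce
  then have np: "n > 0" using n by simp
  have dpos: "d > 0" using cE k np by (simp add: d_def)
  have "real (card E) \<le> 2 * real k * real (card A)"
    using of_nat_mono[OF cEA, where 'a = real] by simp
  then have "d \<le> 2 * real k * real (card A) / (4 * real k * real n)"
    unfolding d_def by (intro divide_right_mono) auto
  also have "\<dots> = real (card A) / (2 * real n)" using k by simp
  also have "\<dots> \<le> real (card A) / (2 * real (card V))"
    using n Vp by (intro divide_left_mono) auto
  finally have dle: "d \<le> real (card A) / (2 * real (card V))" .
  have mindeg: "d \<le> real (card (A' `` {v}))" if "v \<in> U" for v
    using U(3)[OF that] dle by (simp add: A'_def)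
  have maxdeg: "real (card (A' `` {v})) \<le> \<Delta>" if "v \<in> U" for v
  proof -
    \<comment> \<open>Different neighbours of \<open>v\<close> belong to different hyperedges
      through \<open>v\<close>, so the degree bound passes to the graph.\<close>
    have "inj_on (ed v) (A' `` {v})"
    proof (rule inj_onI)
      fix x y assume xy: "x \<in> A' `` {v}" "y \<in> A' `` {v}" "ed v x = ed v y"
      then have "{v, x} = {v, y}" using ed(2) by (metis A'_def ImageE Int_iff singletonD)
      then show "x = y" by (auto simp: doubleton_eq_iff)
    qed
    moreover have "ed v ` (A' `` {v}) \<subseteq> {e \<in> E. v \<in> e}"
      using ed(1) ed_sub by (auto simp: A'_def)
    ultimately have "card (A' `` {v}) \<le> card {e \<in> E. v \<in> e}"
      using finE by (intro card_inj_on_le) auto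
    then show ?thesis using deg[of v] that U(1) by fastforce
  qed
  obtain u where u: "u \<in> U" using U(2) by auto
  have Dpos: "\<Delta> > 0" using mindeg[OF u] maxdeg[OF u] dpos by linarith
  define L where "L w = {p \<in> A'. w \<in> ed (fst p) (snd p)}" for w
  have L: "L w \<subseteq> A' \<and> real (card (L w)) \<le> 2 * \<Delta>" if w: "w \<in> V" for w
  proof -
    \<comment> \<open>Each hyperedge through \<open>w\<close> contributes only the two orientations
      of its assigned pair.\<close>
    have "L w \<subseteq> (\<Union>e\<in>{e \<in> E. w \<in> e}. {(x, y). x \<noteq> y \<and> {x, y} = \<phi> e})"
    proof
      fix p assume p: "p \<in> L w"
      then have pA: "(fst p, snd p) \<in> A" by (auto simp: L_def A'_def)
      then have "fst p \<noteq> snd p" using irrA by (metis irrefl_def)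
      then have "p \<in> {(x, y). x \<noteq> y \<and> {x, y} = \<phi> (ed (fst p) (snd p))}"
        using ed(2)[OF pA] by (simp add: case_prod_unfold)
      moreover have "ed (fst p) (snd p) \<in> {e \<in> E. w \<in> e}" using p ed(1)[OF pA] by (simp add: L_def)
      ultimately show "p \<in> (\<Union>e\<in>{e \<in> E. w \<in> e}. {(x, y). x \<noteq> y \<and> {x, y} = \<phi> e})"
        by (rule UN_I[rotated])
    qed
    moreover have fin: "finite {e \<in> E. w \<in> e}" using finE by simp
    moreover have c2: "finite {(x, y). x \<noteq> y \<and> {x, y} = \<phi> e}"
      "card {(x, y). x \<noteq> y \<and> {x, y} = \<phi> e} = 2" if "e \<in> E" for e
      using card_ordered_pairs[of "\<phi> e"] \<phi>[OF that] by auto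
    ultimately have "card (L w) \<le> card (\<Union>e\<in>{e \<in> E. w \<in> e}. {(x, y). x \<noteq> y \<and> {x, y} = \<phi> e})"
      by (intro card_mono) auto
    also have "\<dots> \<le> (\<Sum>e\<in>{e \<in> E. w \<in> e}. card {(x, y). x \<noteq> y \<and> {x, y} = \<phi> e})"
      by (rule card_UN_le[OF fin])
    also have "\<dots> = (\<Sum>e\<in>{e \<in> E. w \<in> e}. 2)" by (rule sum.cong) (auto simp: c2(2))
    finally show ?thesis using deg[OF w] by (auto simp: L_def)
  qed
  have "card U \<le> n" using card_mono[OF V U(1)] n by simp
  from exists_distinct_closed_walk[of k d \<Delta> V L n, OF _ U(2) dpos Dpos mindeg maxdeg V L this n]
  obtain xs where xs: "xs \<in> closed_walks (2 * k)" "distinct xs"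
    "\<And>w. w \<in> V \<Longrightarrow> \<exists>i<2 * k - 1. (xs ! i, xs ! Suc i) \<notin> L w"
    using k large by (auto simp: d_def not_le)
  have len: "length xs = 2 * k" and ne: "xs \<noteq> []" using xs(1) k by (auto simp: closed_walks_def)
  have st: "(xs ! i, xs ! (Suc i mod (2 * k))) \<in> A'" if i: "i < 2 * k" for i
  proof (cases "Suc i < 2 * k")
    case True
    then show ?thesis
      using xs(1) len successively_nth[of "\<lambda>x y. (x, y) \<in> A'" xs i] by (auto simp: closed_walks_def)
  next
    case False
    then have "i = 2 * k - 1" "Suc i = 2 * k" using i by simp_all
    then have "xs ! i = last xs" "Suc i mod (2 * k) = 0"
      using len ne by (simp_all add: last_conv_nth)
    then show ?thesis using xs(1) ne by (simp add: closed_walks_def hd_conv_nth)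
  qed
  have "\<exists>H\<in>nontrivial_berge_cycles (2 * k). H \<subseteq> E"
  proof (rule nontrivial_berge_cycle_of_closed_walk[OF _ len xs(2), of ed E \<phi>])
    show "ed (xs ! i) (xs ! (Suc i mod (2 * k))) \<in> E \<and>
      \<phi> (ed (xs ! i) (xs ! (Suc i mod (2 * k)))) = {xs ! i, xs ! (Suc i mod (2 * k))}"
      if "i < 2 * k" for i
      using st[OF that] ed by (auto simp: A'_def)
    show "\<exists>i<2 * k. w \<notin> ed (xs ! i) (xs ! (Suc i mod (2 * k)))" for w
    proof (cases "w \<in> V")
      case True
      then obtain i where i: "i < 2 * k - 1" "(xs ! i, xs ! Suc i) \<notin> L w" using xs(3) by blast
      then have "Suc i mod (2 * k) = Suc i" "i < 2 * k" by auto
      then show ?thesis using st[of i] i(2) by (auto simp: L_def)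
    next
      case False
      have "0 < 2 * k" using k by simp
      moreover from this have "ed (xs ! 0) (xs ! (Suc 0 mod (2 * k))) \<subseteq> V"
        using st[of 0] ed(1) E3 by (auto simp: A'_def)
      ultimately show ?thesis using False by blast
    qed
  qed (use k E3 \<phi> in auto)
  then show False using no by blast
qed

section \<open>Independent sets in sparse and almost regular 3-graphs\<close>

text \<open>A colouring that is constant on \<open>e\<close> is determined by its restriction away
  from two vertices of \<open>e\<close>, which copy the colour of the third.\<close>

lemma card_monochromatic_colourings:
  assumes V: "finite V" and e: "e \<subseteq> V" "card e = 3" and q: "q \<ge> 1"
  shows "real (card {c \<in> V \<rightarrow>\<^sub>E {..<q}. \<exists>i. c ` e \<subseteq> {i}}) \<le> real q ^ card V / real q ^ 2"
proof -
  obtain x y z where xyz: "e = {x, y, z}" "x \<noteq> y" "x \<noteq> z" "y \<noteq> z"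
    using e(2) by (auto simp: card_3_iff)
  let ?M = "{c \<in> V \<rightarrow>\<^sub>E {..<q}. \<exists>i. c ` e \<subseteq> {i}}"
  let ?W = "V - {y, z}"
  have "inj_on (\<lambda>c. restrict c ?W) ?M"
  proof (rule inj_onI)
    fix c c' assume c: "c \<in> ?M" "c' \<in> ?M" and eq: "restrict c ?W = restrict c' ?W"
    have out: "c v = c' v" if "v \<in> ?W" for v using fun_cong[OF eq, of v] that by simp
    then have "c x = c' x" using xyz e(1) by auto
    moreover have "c y = c x" "c z = c x" "c' y = c' x" "c' z = c' x" using c xyz by auto
    ultimately have "c v = c' v" if "v \<in> V" for v using out[of v] that
      by (cases "v = y"; cases "v = z") auto
    then show "c = c'" using c by (intro PiE_ext[of c V "\<lambda>_. {..<q}" c']) auto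
  qed
  moreover have "(\<lambda>c. restrict c ?W) ` ?M \<subseteq> ?W \<rightarrow>\<^sub>E {..<q}"
  proof (rule image_subsetI)
    fix c assume "c \<in> ?M"
    then have "\<forall>v\<in>?W. c v \<in> {..<q}" by (auto simp: PiE_iff)
    then show "restrict c ?W \<in> ?W \<rightarrow>\<^sub>E {..<q}" unfolding restrict_PiE_iff .
  qed
  moreover have "finite (?W \<rightarrow>\<^sub>E {..<q})" using V by (intro finite_PiE) auto
  ultimately have "card ?M \<le> card (?W \<rightarrow>\<^sub>E {..<q})" by (rule card_inj_on_le)
  also have "\<dots> = q ^ card ?W" using V by (simp add: card_PiE)
  finally have "card ?M \<le> q ^ card ?W" .
  have cV: "card V = card ?W + 2"
  proof -
    have "card {y, z} = 2" "{y, z} \<subseteq> V" using xyz e(1) by auto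
    then show ?thesis using V card_mono[OF V, of "{y, z}"] by (simp add: card_Diff_subset)
  qed
  have "real q ^ card V / real q ^ 2 = real (q ^ card ?W)"
    using q cV by (simp add: power2_eq_square)
  then show ?thesis using of_nat_mono[OF \<open>card ?M \<le> q ^ card ?W\<close>, where 'a = real] by (simp only:)
qed

text \<open>A random colouring with \<open>q\<close> colours has on average at most
  \<open>card E / q\<^sup>2\<close> monochromatic edges. Some class has at least the average surplus
  of vertices over edges inside it, and one vertex is deleted from each of these edges.\<close>

lemma independent_set_lower_bound:
  assumes G: "three_graph V E" and q: "q \<ge> 1"
  shows "\<exists>I\<subseteq>V. independent_in E I \<and>
    real (card V) - real (card E) / real q ^ 2 \<le> real q * real (card I)"
proof -
  have V: "finite V" and E3: "e \<in> E \<Longrightarrow> e \<subseteq> V \<and> card e = 3" for e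
    using G by (auto simp: three_graph_def nsets_def)
  have finE: "finite E" using V E3 by (meson PowI finite_Pow_iff finite_subset subsetI)
  let ?C = "V \<rightarrow>\<^sub>E {..<q}"
  define mono where "mono c = {e \<in> E. \<exists>i. c ` e \<subseteq> {i}}" for c :: "'a \<Rightarrow> nat"
  have finC: "finite ?C" using V by (intro finite_PiE) auto
  have cC: "real (card ?C) = real q ^ card V" using V by (simp add: card_PiE)
  have "(\<Sum>c\<in>?C. real (card (mono c))) = (\<Sum>c\<in>?C. \<Sum>e\<in>E. if \<exists>i. c ` e \<subseteq> {i} then 1 else 0)"
    using finE by (simp add: mono_def sum.If_cases Int_def)
  also have "\<dots> = (\<Sum>e\<in>E. \<Sum>c\<in>?C. if \<exists>i. c ` e \<subseteq> {i} then 1 else 0)" by (rule sum.swap)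
  also have "\<dots> = (\<Sum>e\<in>E. real (card {c \<in> ?C. \<exists>i. c ` e \<subseteq> {i}}))"
    using finC by (simp add: sum.If_cases Int_def)
  also have "\<dots> \<le> (\<Sum>e\<in>E. real q ^ card V / real q ^ 2)"
    using card_monochromatic_colourings[OF V _ _ q] E3 by (intro sum_mono) auto
  also have "\<dots> = (\<Sum>c\<in>?C. real (card E) / real q ^ 2)" by (simp add: cC)
  finally have "\<exists>c\<in>?C. real (card (mono c)) \<le> real (card E) / real q ^ 2"
    using sum_strict_mono[OF finC, of "\<lambda>_. real (card E) / real q ^ 2" "\<lambda>c. real (card (mono c))"]
      q V by (force simp: PiE_eq_empty_iff not_le)
  then obtain c where c: "c \<in> ?C" "real (card (mono c)) \<le> real (card E) / real q ^ 2" by blast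
  define X where "X i = {v \<in> V. c v = i}" for i
  define M where "M i = {e \<in> E. e \<subseteq> X i}" for i
  have "card V = card (\<Union>i<q. X i)"
    using c(1) by (intro arg_cong[of _ _ card]) (auto simp: X_def)
  also have "\<dots> = (\<Sum>i<q. card (X i))"
    using V by (intro card_UN_disjoint) (auto simp: X_def)
  finally have sX: "(\<Sum>i<q. real (card (X i))) = real (card V)" by simp
  have "(\<Sum>i<q. card (M i)) = card (\<Union>i<q. M i)"
  proof (rule card_UN_disjoint[symmetric])
    show "\<forall>i\<in>{..<q}. \<forall>j\<in>{..<q}. i \<noteq> j \<longrightarrow> M i \<inter> M j = {}"
    proof (intro ballI impI, rule ccontr)
      fix i j :: nat assume "i \<noteq> j" "M i \<inter> M j \<noteq> {}"
      then obtain e where "e \<in> E" "e \<subseteq> X i" "e \<subseteq> X j" by (auto simp: M_def)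
      \<comment> \<open>Colour classes are disjoint, so an edge inside two of them would be empty,
        contrary to its size.\<close>
      then have "e = {}" using \<open>i \<noteq> j\<close> by (auto simp: X_def)
      then show False using E3[OF \<open>e \<in> E\<close>] by simp
    qed
  qed (use finE in \<open>auto simp: M_def\<close>)
  also have "\<dots> \<le> card (mono c)"
    using finE by (intro card_mono) (auto simp: mono_def M_def X_def)
  finally have "real (\<Sum>i<q. card (M i)) \<le> real (card (mono c))" by (rule of_nat_mono)
  then have sM: "(\<Sum>i<q. real (card (M i))) \<le> real (card E) / real q ^ 2"
    using c(2) by simp
  have "\<exists>i<q. (real (card V) - real (card E) / real q ^ 2) / real q \<le> real (card (X i)) - real (card (M i))"
  proof (rule ccontr)
    assume no: "\<not> ?thesis"
    have "(\<Sum>i<q. real (card (X i)) - real (card (M i)))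
      < (\<Sum>i<q. (real (card V) - real (card E) / real q ^ 2) / real q)"
      using no q by (intro sum_strict_mono) (auto simp: not_le lessThan_empty_iff)
    also have "\<dots> = real (card V) - real (card E) / real q ^ 2" using q by simp
    finally show False using sX sM by (simp add: sum_subtractf)
  qed
  then obtain i where i: "(real (card V) - real (card E) / real q ^ 2) / real q
      \<le> real (card (X i)) - real (card (M i))" by blast
  define I where "I = X i - (\<lambda>e. SOME v. v \<in> e) ` M i"
  have fM: "finite (M i)" using finE by (simp add: M_def)
  have "card (X i) - card ((\<lambda>e. SOME v. v \<in> e) ` M i) \<le> card I"
    unfolding I_def using fM by (intro diff_card_le_card_Diff) auto
  then have "real (card (X i)) - real (card (M i)) \<le> real (card I)"
    using card_image_le[OF fM, of "\<lambda>e. SOME v. v \<in> e"] by linarith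
  then have "(real (card V) - real (card E) / real q ^ 2) / real q \<le> real (card I)" using i by linarith
  then have "real (card V) - real (card E) / real q ^ 2 \<le> real q * real (card I)"
    using q by (simp add: field_simps)
  moreover have "independent_in E I"
    unfolding independent_in_def
  proof (intro ballI notI)
    fix e assume e: "e \<in> E" "e \<subseteq> I"
    then have "e \<in> M i" by (auto simp: M_def I_def)
    moreover have "(SOME v. v \<in> e) \<in> e" using E3[OF e(1)] by (metis card.empty ex_in_conv some_in_eq zero_neq_numeral)
    ultimately show False using e(2) by (auto simp: I_def)
  qed
  moreover have "I \<subseteq> V" by (auto simp: I_def X_def)
  ultimately show ?thesis by blast
qed

text \<open>While some vertex lies in more than the fraction \<open>\<mu> / n\<close> of the
  remaining edges, delete it. Either this stops at a set with bounded degrees, or each deletion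
  shrinks the number of edges by the factor \<open>1 - \<mu> / n\<close>.\<close>

lemma regularise_degrees:
  assumes V: "finite V" "card V = n" and E: "finite E" and mu: "0 \<le> \<mu>" "\<mu> \<le> real n" and j: "j \<le> n"
  shows "\<exists>S\<subseteq>V. n - j \<le> card S \<and>
    ((\<forall>v\<in>S. real (card {e \<in> E. e \<subseteq> S \<and> v \<in> e}) \<le> \<mu> * real (card {e \<in> E. e \<subseteq> S}) / real n) \<or>
     real (card {e \<in> E. e \<subseteq> S}) \<le> real (card E) * (1 - \<mu> / real n) ^ j)"
  using j
proof (induction j)
  case 0
  have "real (card {e \<in> E. e \<subseteq> V}) \<le> real (card E) * (1 - \<mu> / real n) ^ 0"
    using card_mono[OF E, of "{e \<in> E. e \<subseteq> V}"] by auto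
  then show ?case using V(2) by (intro exI[of _ V]) auto
next
  case (Suc j)
  have np: "n > 0" using Suc.prems by simp
  then have r: "0 \<le> 1 - \<mu> / real n" using mu by (simp add: field_simps)
  obtain S where S: "S \<subseteq> V" "n - j \<le> card S" and alt:
    "(\<forall>v\<in>S. real (card {e \<in> E. e \<subseteq> S \<and> v \<in> e}) \<le> \<mu> * real (card {e \<in> E. e \<subseteq> S}) / real n) \<or>
     real (card {e \<in> E. e \<subseteq> S}) \<le> real (card E) * (1 - \<mu> / real n) ^ j"
    using Suc by auto
  show ?case
  proof (cases "\<forall>v\<in>S. real (card {e \<in> E. e \<subseteq> S \<and> v \<in> e}) \<le> \<mu> * real (card {e \<in> E. e \<subseteq> S}) / real n")
    case True
    then show ?thesis using S by (intro exI[of _ S]) auto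
  next
    case False
    then obtain v where v: "v \<in> S"
      "\<mu> * real (card {e \<in> E. e \<subseteq> S}) / real n < real (card {e \<in> E. e \<subseteq> S \<and> v \<in> e})"
      by (auto simp: not_le)
    have "{e \<in> E. e \<subseteq> S} = {e \<in> E. e \<subseteq> S - {v}} \<union> {e \<in> E. e \<subseteq> S \<and> v \<in> e}" by auto
    moreover have "card ({e \<in> E. e \<subseteq> S - {v}} \<union> {e \<in> E. e \<subseteq> S \<and> v \<in> e})
      = card {e \<in> E. e \<subseteq> S - {v}} + card {e \<in> E. e \<subseteq> S \<and> v \<in> e}"
      using E by (intro card_Un_disjoint) auto
    ultimately have "card {e \<in> E. e \<subseteq> S} = card {e \<in> E. e \<subseteq> S - {v}} + card {e \<in> E. e \<subseteq> S \<and> v \<in> e}"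
      by (rule back_subst[of "\<lambda>X. card X = _", OF _ sym, rotated])
    then have "real (card {e \<in> E. e \<subseteq> S}) =
        real (card {e \<in> E. e \<subseteq> S - {v}}) + real (card {e \<in> E. e \<subseteq> S \<and> v \<in> e})"
      by simp
    then have "real (card {e \<in> E. e \<subseteq> S - {v}}) \<le> (1 - \<mu> / real n) * real (card {e \<in> E. e \<subseteq> S})"
      using v(2) by (simp add: algebra_simps add_divide_distrib)
    also have "\<dots> \<le> (1 - \<mu> / real n) * (real (card E) * (1 - \<mu> / real n) ^ j)"
      using alt False r by (intro mult_left_mono) auto
    finally have "real (card {e \<in> E. e \<subseteq> S - {v}}) \<le> real (card E) * (1 - \<mu> / real n) ^ Suc j"
      by (simp add: algebra_simps)
    moreover have "finite S" using S V finite_subset by blast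
    then have "n - Suc j \<le> card (S - {v})" using S v(1) by simp
    ultimately show ?thesis using S(1) by (intro exI[of _ "S - {v}"]) auto
  qed
qed

text \<open>If \<open>n div 2\<close> deletions did not end with bounded degrees, fewer than one of
  the at most \<open>n ^ 3\<close> edges would survive, and an edgeless set satisfies the bound
  anyway.\<close>

lemma almost_regular_subset:
  assumes G: "three_graph V E" "card V = n" and n: "n \<ge> 4" and ln: "8 * ln (real n) \<le> real n"
  shows "\<exists>S\<subseteq>V. real n / 2 \<le> real (card S) \<and>
    (\<forall>v\<in>S. real (card {e \<in> E. e \<subseteq> S \<and> v \<in> e})
       \<le> 8 * ln (real n) * real (card {e \<in> E. e \<subseteq> S}) / real n)"
proof -
  have V: "finite V" and E3: "e \<in> E \<Longrightarrow> e \<subseteq> V \<and> card e = 3" for e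
    using G by (auto simp: three_graph_def nsets_def)
  have finE: "finite E" using V E3 by (meson PowI finite_Pow_iff finite_subset subsetI)
  define \<mu> where "\<mu> = 8 * ln (real n)"
  have mpos: "\<mu> > 0" using n by (simp add: \<mu>_def)
  have mle: "\<mu> \<le> real n" using ln by (simp add: \<mu>_def)
  define j where "j = n div 2"
  obtain S where S: "S \<subseteq> V" "n - j \<le> card S" and alt:
    "(\<forall>v\<in>S. real (card {e \<in> E. e \<subseteq> S \<and> v \<in> e}) \<le> \<mu> * real (card {e \<in> E. e \<subseteq> S}) / real n) \<or>
     real (card {e \<in> E. e \<subseteq> S}) \<le> real (card E) * (1 - \<mu> / real n) ^ j"
    using regularise_degrees[OF V G(2) finE less_imp_le[OF mpos] mle, of j] by (auto simp: j_def)
  have half: "real n / 2 \<le> real (card S)" using S(2) by (simp add: j_def)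
  have "\<forall>v\<in>S. real (card {e \<in> E. e \<subseteq> S \<and> v \<in> e}) \<le> \<mu> * real (card {e \<in> E. e \<subseteq> S}) / real n"
  proof (rule ccontr)
    assume irreg: "\<not> ?thesis"
    then have 1: "real (card {e \<in> E. e \<subseteq> S}) \<le> real (card E) * (1 - \<mu> / real n) ^ j" using alt by blast
    have cE: "card E \<le> n ^ 3"
    proof -
      have "card E \<le> card ([V]\<^bsup>3\<^esup>)"
        using G(1) finite_imp_finite_nsets[OF V] by (intro card_mono) (auto simp: three_graph_def)
      also have "\<dots> = n choose 3" using G(2) V by (simp add: card_nsets)
      also have "\<dots> \<le> (n choose 3) * fact 3" by simp
      also have "\<dots> \<le> n ^ 3" by (rule binomial_fact_pow)
      finally show ?thesis .
    qed
    have 2: "(1 - \<mu> / real n) ^ j \<le> exp (- \<mu> / real n) ^ j"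
      using exp_ge_add_one_self[of "- \<mu> / real n"] mle n by (intro power_mono) auto
    have 3: "exp (- \<mu> / real n) ^ j < 1 / real n ^ 3"
    proof -
      \<comment> \<open>With rounding, \<open>8 * j\<close> is \<open>4 * n\<close> or
        \<open>4 * n - 4\<close>, which exceeds \<open>3 * n\<close> for \<open>n \<ge> 4\<close>;
        the factor 8 in \<open>\<mu>\<close> thus beats the exponent of
        \<open>n ^ 3\<close>.\<close>
      have "n * 3 < j * 8" using n unfolding j_def by presburger
      then have "real n * 3 < real j * 8" by linarith
      then have "3 * ln (real n) < real j * (\<mu> / real n)"
        using n by (simp add: \<mu>_def field_simps)
      then have "exp (real j * (- \<mu> / real n)) < exp (- (3 * ln (real n)))" by simp
      also have "exp (- (3 * ln (real n))) = 1 / exp (ln (real n)) ^ 3"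
        using exp_of_nat_mult[of 3 "ln (real n)"] by (simp add: exp_minus field_simps)
      also have "\<dots> = 1 / real n ^ 3" using n by simp
      finally show ?thesis unfolding exp_of_nat_mult .
    qed
    note 1
    also have "real (card E) * (1 - \<mu> / real n) ^ j \<le> real (n ^ 3) * (1 - \<mu> / real n) ^ j"
      using cE mle n by (intro mult_right_mono of_nat_mono) auto
    also have "\<dots> < real (n ^ 3) * (1 / real n ^ 3)"
      using 2 3 n by (intro mult_strict_left_mono) auto
    also have "\<dots> = 1" using n by simp
    finally have "real (card {e \<in> E. e \<subseteq> S}) < 1" .
    then have "card {e \<in> E. e \<subseteq> S} = 0" by simp
    then have none: "{e \<in> E. e \<subseteq> S} = {}" using finE by simp
    have "card {e \<in> E. e \<subseteq> S \<and> v \<in> e} = 0" for v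
      using none by (metis (no_types, lifting) Collect_empty_eq card.empty)
    then show False using irreg \<open>card {e \<in> E. e \<subseteq> S} = 0\<close> by (simp only:) simp
  qed
  then show ?thesis using S(1) half unfolding \<mu>_def by blast
qed

section \<open>The Ramsey bound\<close>

text \<open>In the almost regular part with \<open>x = card F / n\<close>, degrees are at most
  \<open>8 * ln n * x\<close>. So \<open>edges_le_of_no_berge_cycle\<close>, after
  \<open>k\<close>-th roots, bounds the square of \<open>x\<close> by a multiple of
  \<open>x\<close>, and the colouring bound applies to a hypergraph with few edges.\<close>

lemma independent_set_of_no_berge_cycle:
  assumes G: "three_graph V E" "card V = n" and k: "k \<ge> 2"
    and no: "\<not> (\<exists>H\<in>nontrivial_berge_cycles (2 * k). H \<subseteq> E)"
    and n: "n \<ge> 4" "8 * ln (real n) \<le> real n"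
  shows "\<exists>I\<subseteq>V. independent_in E I \<and>
    real n \<le> 12 * sqrt (8192 * real k ^ 5 * real n powr (1 / real k) * ln (real n)) * real (card I)"
proof -
  have V: "finite V" using G by (simp add: three_graph_def)
  obtain S where S: "S \<subseteq> V" "real n / 2 \<le> real (card S)" and
    reg: "\<And>v. v \<in> S \<Longrightarrow> real (card {e \<in> E. e \<subseteq> S \<and> v \<in> e})
       \<le> 8 * ln (real n) * real (card {e \<in> E. e \<subseteq> S}) / real n"
    using almost_regular_subset[OF G n] by blast
  define F where "F = {e \<in> E. e \<subseteq> S}"
  have GS: "three_graph S F"
    using G(1) S(1) finite_subset[OF S(1) V] by (auto simp: three_graph_def nsets_def F_def)
  define x where "x = real (card F) / real n"
  \<comment> \<open>Here \<open>8192 = 16 * 64 * 8\<close>: the square of the 4 and the 64 from the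
    edge bound, and the 8 from the degree bound.\<close>
  define X where "X = 8192 * real k ^ 5 * real n powr (1 / real k) * ln (real n)"
  have "exp 1 \<le> real n" using exp_le n(1) by linarith
  then have ln1: "ln (real n) \<ge> 1" using n(1) by (simp add: ln_ge_iff)
  have X0: "X \<ge> 1"
  proof -
    have "1 * 1 * 1 * 1 \<le> X"
      unfolding X_def using k n(1) ln1 by (intro mult_mono) (auto simp: ge_one_powr_ge_zero)
    then show ?thesis by simp
  qed
  have xX: "x \<le> X"
  proof (cases "F = {}")
    case True
    then show ?thesis using X0 by (simp add: x_def)
  next
    case False
    have "card S \<le> n" using card_mono[OF V S(1)] G(2) by simp
    moreover have "\<not> (\<exists>H\<in>nontrivial_berge_cycles (2 * k). H \<subseteq> F)" using no by (auto simp: F_def)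
    moreover have "real (card {e \<in> F. v \<in> e}) \<le> 8 * ln (real n) * x" if "v \<in> S" for v
      using reg[OF that] by (simp add: F_def x_def conj_assoc)
    ultimately have "(real (card F) / (4 * real k * real n)) ^ (2 * k)
        \<le> real n * (64 * real k ^ 3 * (8 * ln (real n) * x)) ^ k"
      using edges_le_of_no_berge_cycle[OF GS k _ _ False] by blast
    also have "real (card F) / (4 * real k * real n) = x / (4 * real k)" by (simp add: x_def)
    finally have "(x / (4 * real k)) ^ (2 * k)
        \<le> real n * (64 * real k ^ 3 * (8 * ln (real n) * x)) ^ k" .
    moreover have "(real n powr (1 / real k)) ^ k = real n"
      using n(1) k by (simp add: powr_realpow[symmetric] powr_powr)
    ultimately have "((x / (4 * real k))\<^sup>2) ^ k
        \<le> (real n powr (1 / real k) * (64 * real k ^ 3 * (8 * ln (real n) * x))) ^ k"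
      using power_mult_distrib[of "real n powr (1 / real k)" _ k] by (simp only: power_mult)
    moreover have "finite F"
      using GS finite_subset finite_imp_finite_nsets unfolding three_graph_def by blast
    then have x0: "x > 0" using False n(1) by (simp add: x_def card_gt_0_iff)
    ultimately have "(x / (4 * real k))\<^sup>2
        \<le> real n powr (1 / real k) * (64 * real k ^ 3 * (8 * ln (real n) * x))"
      using k ln1 by (subst (asm) power_mono_iff) auto
    then have "x * x \<le> x * (16 * real k ^ 2 * (real n powr (1 / real k) * (64 * real k ^ 3 * (8 * ln (real n)))))"
      using k by (simp add: field_simps power2_eq_square)
    then have "x \<le> 16 * real k ^ 2 * (real n powr (1 / real k) * (64 * real k ^ 3 * (8 * ln (real n))))"
      using x0 by (simp only: mult_le_cancel_left_pos)
    also have "\<dots> = X" by (simp add: X_def power2_eq_square power3_eq_cube eval_nat_numeral)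
    finally show ?thesis .
  qed
  \<comment> \<open>With this \<open>q\<close> the edges cost at most \<open>n / 4\<close> of the at
    least \<open>n / 2\<close> vertices. As \<open>q \<le> 3 * sqrt X\<close>, the final constant is
    \<open>12 = 4 * 3\<close>.\<close>
  define q where "q = nat \<lceil>2 * sqrt X\<rceil>"
  have sX: "sqrt X \<ge> 1" using X0 by simp
  have q: "2 * sqrt X \<le> real q" "real q \<le> 2 * sqrt X + 1"
    using sX unfolding q_def by linarith+
  then have q1: "q \<ge> 1" using sX by linarith
  obtain I where I: "I \<subseteq> S" "independent_in F I"
    "real (card S) - real (card F) / real q ^ 2 \<le> real q * real (card I)"
    using independent_set_lower_bound[OF GS q1] by blast
  have "(2 * sqrt X)\<^sup>2 \<le> (real q)\<^sup>2" using q(1) sX by (intro power_mono) auto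
  then have "4 * X \<le> (real q)\<^sup>2" using X0 by (simp add: power_mult_distrib)
  then have "4 * x \<le> (real q)\<^sup>2" using xX by linarith
  then have "4 * x * real n \<le> (real q)\<^sup>2 * real n" by (rule mult_right_mono) simp
  then have "real (card F) / real q ^ 2 \<le> real n / 4"
    using q1 n(1) by (simp add: x_def field_simps)
  then have "real n / 4 \<le> real q * real (card I)" using I(3) S(2) by linarith
  also have "\<dots> \<le> (3 * sqrt X) * real (card I)"
    by (rule mult_right_mono) (use q(2) sX in linarith, simp)
  finally have "real n \<le> 12 * sqrt X * real (card I)" by simp
  moreover have "independent_in E I"
    using I(1,2) by (auto simp: independent_in_def F_def)
  ultimately show ?thesis using I(1) S(1) unfolding X_def by blast
qed

text \<open>Put \<open>s = sqrt (ln t)\<close> and let \<open>\<beta> = 1 - 1 / (2 * k)\<close>, the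
  reciprocal of the main exponent. Then \<open>T powr \<beta> = t * exp (4 * \<beta> * s)\<close>,
  so the term \<open>4 / sqrt (ln t)\<close> in the exponent yields a surplus over \<open>t\<close>
  that absorbs the constants and \<open>sqrt (ln n)\<close>.\<close>

lemma eventually_ramsey_bound:
  assumes k: "k \<ge> 3"
  shows "\<forall>\<^sub>F t in sequentially.
    let T = real t powr (2 * real k / (2 * real k - 1) + 4 / sqrt (ln (real t))); n = nat \<lfloor>T\<rfloor> in
      n \<ge> 4 \<and> 8 * ln (real n) \<le> real n \<and>
      real t * (12 * sqrt (8192 * real k ^ 5 * real n powr (1 / real k) * ln (real n))) \<le> real n"
proof -
  define C where "C = sqrt (8192 * real k ^ 5)"
  have C: "C > 0" using k by (simp add: C_def)
  have "\<forall>\<^sub>F s in at_top. 24 * C * sqrt (2 * s\<^sup>2 + 4 * s) \<le> exp (3 * s)"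
    using C by real_asymp
  moreover have "filterlim (\<lambda>t::nat. sqrt (ln (real t))) at_top sequentially" by real_asymp
  ultimately have ev1: "\<forall>\<^sub>F t::nat in sequentially. 24 * C * sqrt (2 * (sqrt (ln (real t)))\<^sup>2 + 4 * sqrt (ln (real t)))
      \<le> exp (3 * sqrt (ln (real t)))"
    by (rule eventually_compose_filterlim)
  have "\<forall>\<^sub>F n::nat in sequentially. 8 * ln (real n) \<le> real n" by real_asymp
  then obtain N where N: "\<And>n. n \<ge> N \<Longrightarrow> 8 * ln (real n) \<le> real n"
    by (auto simp: eventually_sequentially)
  show ?thesis
    using ev1 eventually_ge_at_top[of N] eventually_ge_at_top[of 4]
  proof eventually_elim
    case (elim t)
    define L where "L = ln (real t)"
    define s where "s = sqrt L"
    define \<alpha> where "\<alpha> = 2 * real k / (2 * real k - 1)"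
    define \<beta> where "\<beta> = 1 - 1 / (2 * real k)"
    define T where "T = real t powr (\<alpha> + 4 / s)"
    define n where "n = nat \<lfloor>T\<rfloor>"
    have t: "t \<ge> 4" "t \<ge> N" using elim by auto
    have Lpos: "L > 0" using t by (simp add: L_def)
    then have s: "s > 0" "s\<^sup>2 = L" by (simp_all add: s_def)
    have \<alpha>: "1 \<le> \<alpha>" "\<alpha> \<le> 2" using k by (simp_all add: \<alpha>_def field_simps)
    have \<beta>: "\<beta> * \<alpha> = 1" "5 / 6 \<le> \<beta>" "\<beta> \<le> 1"
      using k by (simp_all add: \<alpha>_def \<beta>_def field_simps)
    have Le: "L / s = s" using s by (simp add: power2_eq_square field_simps)
    have Texp: "T = exp (\<alpha> * L + 4 * s)"
    proof -
      have "(\<alpha> + 4 / s) * L = \<alpha> * L + 4 * (L / s)" by (simp add: algebra_simps)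
      then show ?thesis using t by (simp add: T_def powr_def L_def[symmetric] Le)
    qed
    have "4 / s > 0" using s by simp
    then have "1 \<le> \<alpha> + 4 / s" using \<alpha> by linarith
    then have "real t powr 1 \<le> T"
      unfolding T_def using t by (intro powr_mono) auto
    then have tT: "real t \<le> T" using t by simp
    then have nt: "t \<le> n" unfolding n_def by linarith
    \<comment> \<open>Since \<open>T \<ge> t \<ge> 4\<close>, rounding down costs at most a factor
      2.\<close>
    have nT: "real n \<le> T" "T / 2 \<le> real n" using tT t unfolding n_def by linarith+
    have npos: "real n > 0" using nt t by simp
    have "ln (real n) \<le> ln T" using nT npos by simp
    also have "\<dots> = \<alpha> * L + 4 * s" by (simp add: Texp)
    also have "\<dots> \<le> 2 * s\<^sup>2 + 4 * s" using \<alpha> Lpos s by simp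
    finally have lnn: "sqrt (ln (real n)) \<le> sqrt (2 * s\<^sup>2 + 4 * s)" by simp
    have "sqrt (real n powr (1 / real k)) = real n powr (1 / (2 * real k))"
      using npos by (simp add: powr_half_sqrt[symmetric] powr_powr mult.commute)
    then have "sqrt (8192 * real k ^ 5 * real n powr (1 / real k) * ln (real n))
        = C * real n powr (1 / (2 * real k)) * sqrt (ln (real n))"
      by (simp add: real_sqrt_mult C_def)
    also have "\<dots> \<le> C * real n powr (1 / (2 * real k)) * sqrt (2 * s\<^sup>2 + 4 * s)"
      using lnn C by (intro mult_left_mono) auto
    finally have "24 * sqrt (8192 * real k ^ 5 * real n powr (1 / real k) * ln (real n))
        \<le> real n powr (1 / (2 * real k)) * (24 * C * sqrt (2 * s\<^sup>2 + 4 * s))"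
      by (simp add: algebra_simps)
    also have "\<dots> \<le> real n powr (1 / (2 * real k)) * exp (3 * s)"
      using elim(1) by (intro mult_left_mono) (auto simp: s_def L_def)
    finally have A: "24 * sqrt (8192 * real k ^ 5 * real n powr (1 / real k) * ln (real n))
        \<le> real n powr (1 / (2 * real k)) * exp (3 * s)" .
    have "real t * exp (3 * s) \<le> exp (L + 4 * \<beta> * s)"
    proof -
      have "real t = exp L" using t by (simp add: L_def)
      \<comment> \<open>From \<open>\<beta> \<ge> 5 / 6\<close> follows
        \<open>4 * \<beta> \<ge> 10 / 3\<close>.\<close>
      moreover have "3 * s \<le> 4 * \<beta> * s" using \<beta> s by (intro mult_right_mono) auto
      ultimately show ?thesis by (simp add: exp_add[symmetric])
    qed
    also have "L + 4 * \<beta> * s = \<beta> * (\<alpha> * L + 4 * s)" using \<beta>(1) by (simp add: algebra_simps)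
    also have "exp \<dots> = T powr \<beta>" by (simp add: Texp powr_def)
    also have "\<dots> \<le> (2 * real n) powr \<beta>" using nT \<beta> tT by (intro powr_mono2) auto
    also have "\<dots> = 2 powr \<beta> * real n powr \<beta>" using npos by (simp add: powr_mult)
    also have "\<dots> \<le> 2 * real n powr \<beta>"
      using powr_mono[of \<beta> 1 2] \<beta> by (intro mult_right_mono) auto
    finally have B: "real t * exp (3 * s) \<le> 2 * real n powr \<beta>" .
    have "real t * (24 * sqrt (8192 * real k ^ 5 * real n powr (1 / real k) * ln (real n)))
        \<le> real t * (real n powr (1 / (2 * real k)) * exp (3 * s))"
      using A by (intro mult_left_mono) auto
    also have "\<dots> = real n powr (1 / (2 * real k)) * (real t * exp (3 * s))" by simp
    also have "\<dots> \<le> real n powr (1 / (2 * real k)) * (2 * real n powr \<beta>)"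
      using B by (intro mult_left_mono) auto
    also have "\<dots> = 2 * real n" using npos by (simp add: \<beta>_def powr_add[symmetric])
    finally have "real t * (12 * sqrt (8192 * real k ^ 5 * real n powr (1 / real k) * ln (real n))) \<le> real n"
      by simp
    moreover have "8 * ln (real n) \<le> real n" using N nt t by simp
    moreover have "n \<ge> 4" using nt t by simp
    ultimately show ?case
      unfolding n_def T_def \<alpha>_def s_def L_def Let_def by blast
  qed
qed

theorem theorem1:
  fixes k :: nat
  assumes "k \<ge> 3"
  shows "\<forall>\<^sub>F t in sequentially.
    real (ramsey_number t (nontrivial_berge_cycles (2 * k)))
      \<le> real t powr (2 * real k / (2 * real k - 1) + 4 / sqrt (ln (real t)))"
  using eventually_ramsey_bound[OF assms]
proof eventually_elim
  case (elim t)
  define T where "T = real t powr (2 * real k / (2 * real k - 1) + 4 / sqrt (ln (real t)))"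
  define n where "n = nat \<lfloor>T\<rfloor>"
  define X where "X = 12 * sqrt (8192 * real k ^ 5 * real n powr (1 / real k) * ln (real n))"
  have n: "n \<ge> 4" "8 * ln (real n) \<le> real n" and t: "real t * X \<le> real n"
    using elim unfolding Let_def T_def[symmetric] n_def[symmetric] X_def by auto
  \<comment> \<open>The Ramsey number is a least value, so it is enough to verify the property at
    the integer part of \<open>T\<close>.\<close>
  have "ramsey_prop t (nontrivial_berge_cycles (2 * k)) n"
    unfolding ramsey_prop_def
  proof (intro allI impI disjCI)
    fix V :: "nat set" and E
    assume VE: "three_graph V E \<and> card V = n"
      and no: "\<not> (\<exists>I\<subseteq>V. card I = t \<and> independent_in E I)"
    show "\<exists>H\<in>nontrivial_berge_cycles (2 * k). H \<subseteq> E"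
    proof (rule ccontr)
      assume "\<not> ?thesis"
      then obtain I where I: "I \<subseteq> V" "independent_in E I" "real n \<le> X * real (card I)"
        using independent_set_of_no_berge_cycle[of V E n k] VE n assms unfolding X_def by auto
      have "X > 0" using n(1) assms by (simp add: X_def)
      moreover have "X * real t \<le> X * real (card I)" using t I(3) by (simp add: mult.commute)
      ultimately have "t \<le> card I" by simp
      \<comment> \<open>Independence passes to subsets, so the independent set can be cut down to
        exactly \<open>t\<close> vertices.\<close>
      then obtain J where "J \<subseteq> I" "card J = t" by (meson obtain_subset_with_card_n)
      then have "J \<subseteq> V" "card J = t" "independent_in E J"
        using I(1,2) unfolding independent_in_def by blast+
      then show False using no by blast
    qed
  qed
  then have "ramsey_number t (nontrivial_berge_cycles (2 * k)) \<le> n"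
    unfolding ramsey_number_def by (rule Least_le)
  moreover have "real n \<le> T" unfolding n_def T_def by simp
  ultimately show ?case unfolding T_def by linarith
qed

end
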